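(* Consider a dimension vector $\underline{\mathbf d}=(a_1,\dots,a_r,b,b;n)$ with $b+\sum_{i=1}^r a_i=n$ and $b\le \frac n2$. Then $\underline{\mathbf d}$ is dense if the dimension vector $\underline{\mathbf d}'=(a_1,\dots,a_r,b;n-b)$ is dense.
   Context: Work over an algebraically closed field of arbitrary characteristic. $Gr(d;n)$ is the Grassmannian of $d$-dimensional linear subspaces of a fixed $n$-dimensional vector space. A dimension vector $(d_1,\dots,d_m;n)$ consists of integers with $1\le d_i\le n-1$; it is dense if the diagonal action of $\mathbb{P}GL(n)$ on $\prod_{i} Gr(d_i;n)$ has a Zariski dense orbit. In the vector $\underline{\mathbf d}'$, entries equal to the ambient dimension are allowed; the corresponding Grassmannian is a point, so such entries can be dropped. *)

theory Defs
  imports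
    "HOL-Analysis.Abstract_Topology"
    "HOL-Algebra.Coset"
    "HOL-Computational_Algebra.Polynomial"
    "Jordan_Normal_Form.DL_Rank"
    "Jordan_Normal_Form.DL_Submatrix"
begin

section \<open>Products of Grassmannians\<close>

definition Gr :: "nat \<Rightarrow> nat \<Rightarrow> 'a::field vec set set" where
  "Gr d n = {W. VectorSpace.subspace class_ring W (module_vec TYPE('a) n) \<and>
     vectorspace.dim class_ring ((module_vec TYPE('a) n)\<lparr>carrier := W\<rparr>) = d}"

definition dimension_vector :: "nat list \<Rightarrow> nat \<Rightarrow> bool" where
  "dimension_vector ds n \<longleftrightarrow> (\<forall>d \<in> set ds. 1 \<le> d \<and> d \<le> n - 1)"

text \<open>A point of \<open>Gr(d\<^sub>1;n) \<times> \<dots> \<times> Gr(d\<^sub>m;n)\<close> is the list of its components (indexed from 0).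
  An entry \<open>d\<^sub>i = n\<close> contributes a factor with the single point \<^term>\<open>carrier_vec n\<close>.\<close>

definition Gr_prod :: "nat list \<Rightarrow> nat \<Rightarrow> 'a::field vec set list set" where
  "Gr_prod ds n = {Ws. length Ws = length ds \<and> (\<forall>i < length ds. Ws ! i \<in> Gr (ds ! i) n)}"

section \<open>The Zariski topology\<close>

text \<open>The columns of a basis matrix are an ordered basis: \<open>d\<close> vectors that span a space of
  dimension \<open>d\<close>.\<close>

definition basis_matrix :: "nat \<Rightarrow> nat \<Rightarrow> 'a::field vec set \<Rightarrow> 'a mat \<Rightarrow> bool" where
  "basis_matrix d n W M \<longleftrightarrow> W \<in> Gr d n \<and> M \<in> carrier_mat n d \<and> vec_space.col_space n M = W"

definition basis_matrices ::
    "nat list \<Rightarrow> nat \<Rightarrow> 'a::field vec set list \<Rightarrow> 'a mat list \<Rightarrow> bool" where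
  "basis_matrices ds n Ws Ms \<longleftrightarrow> length Ws = length ds \<and> length Ms = length ds \<and>
     (\<forall>i < length ds. basis_matrix (ds ! i) n (Ws ! i) (Ms ! i))"

text \<open>The Pluecker coordinate \<open>(i, J)\<close> is the maximal minor of the \<open>i\<close>-th basis matrix whose
  rows are those in \<open>J\<close>.  For fixed \<open>i\<close>, another choice of basis rescales all of them by one
  common nonzero factor.\<close>

definition pluecker :: "'a::field mat list \<Rightarrow> nat \<times> nat set \<Rightarrow> 'a" where
  "pluecker Ms = (\<lambda>(i, J). det (submatrix (Ms ! i) J UNIV))"

text \<open>Polynomials, as functions, in the Pluecker coordinates that are homogeneous of degree
  \<open>e i\<close> in the coordinates of the \<open>i\<close>-th factor.  Over an infinite field, such as an
  algebraically closed one, polynomials and polynomial functions are the same.\<close>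

inductive multihomogeneous ::
    "nat list \<Rightarrow> nat \<Rightarrow> (nat \<Rightarrow> nat) \<Rightarrow> ((nat \<times> nat set \<Rightarrow> 'a::field) \<Rightarrow> 'a) \<Rightarrow> bool"
  for ds n where
  const: "multihomogeneous ds n (\<lambda>_. 0) (\<lambda>_. c)"
| coord: "multihomogeneous ds n ((\<lambda>_. 0)(i := 1)) (\<lambda>x. x (i, J))"
    if "i < length ds" "J \<subseteq> {..<n}" "card J = ds ! i"
| add: "multihomogeneous ds n e (\<lambda>x. f x + g x)"
    if "multihomogeneous ds n e f" "multihomogeneous ds n e g"
| mult: "multihomogeneous ds n (\<lambda>i. e i + e' i) (\<lambda>x. f x * g x)"
    if "multihomogeneous ds n e f" "multihomogeneous ds n e' g"

definition zero_locus ::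
    "nat list \<Rightarrow> nat \<Rightarrow> ((nat \<times> nat set \<Rightarrow> 'a::field) \<Rightarrow> 'a) \<Rightarrow> 'a vec set list set" where
  "zero_locus ds n f =
     {Ws \<in> Gr_prod ds n. \<forall>Ms. basis_matrices ds n Ws Ms \<longrightarrow> f (pluecker Ms) = 0}"

text \<open>The Zariski topology of the multiprojective variety that is the image of the product under
  the Pluecker embeddings.  The complements of the loci \<open>f = 0\<close> are closed under finite
  intersections (multiply the polynomials), so they form a basis, and the closed sets are the
  common zero loci of families of multihomogeneous polynomials.\<close>

definition zariski :: "nat list \<Rightarrow> nat \<Rightarrow> 'a::field vec set list topology" where
  "zariski ds n = topology_generated_by
     {Gr_prod ds n - zero_locus ds n f | e f. multihomogeneous ds n e f}"

section \<open>The action of the projective linear group\<close>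

definition GL :: "'a::field itself \<Rightarrow> nat \<Rightarrow> 'a mat monoid" where
  "GL ty n = units_of (ring_mat ty n ())"

definition PGL :: "'a::field itself \<Rightarrow> nat \<Rightarrow> 'a mat set monoid" where
  "PGL ty n = GL ty n Mod {c \<cdot>\<^sub>m 1\<^sub>m n | c. c \<noteq> 0}"

text \<open>An element of \<open>PGL\<close> is a set of matrices that are nonzero multiples of each other, so
  they all map \<open>W\<close> onto the same subspace.\<close>

definition PGL_act :: "'a::field mat set \<Rightarrow> 'a vec set \<Rightarrow> 'a vec set" where
  "PGL_act P W = {g *\<^sub>v w | g w. g \<in> P \<and> w \<in> W}"

definition PGL_orbit :: "nat \<Rightarrow> 'a::field vec set list \<Rightarrow> 'a vec set list set" where
  "PGL_orbit n Ws = {map (PGL_act P) Ws | P. P \<in> carrier (PGL TYPE('a) n)}"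

definition dense_dim_vector :: "'a::field itself \<Rightarrow> nat list \<Rightarrow> nat \<Rightarrow> bool" where
  "dense_dim_vector ty ds n \<longleftrightarrow>
     (\<exists>Ws :: 'a vec set list \<in> Gr_prod ds n. zariski ds n closure_of PGL_orbit n Ws = Gr_prod ds n)"

end

theory Submission
  imports Defs
begin

text \<open>Put \<open>m = n - b = \<Sum> a\<^sub>i\<close>.  A generic tuple \<open>(A\<^sub>1, \<dots>, A\<^sub>r, B)\<close> decomposes \<open>V\<close> as a direct sum, and all
  such decompositions are conjugate.  Relative to one of them, the remaining subspace \<open>B'\<close> is the
  column space of a matrix with an upper part \<open>Q\<close> of size \<open>m \<times> b\<close>, with values in
  \<open>V/B = A\<^sub>1 \<oplus> \<dots> \<oplus> A\<^sub>r\<close>, and a lower part \<open>S\<close> of size \<open>b \<times> b\<close>, with values in \<open>B\<close>.  Generically \<open>S\<close>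
  is invertible, so \<open>B'\<close> is the graph of a linear map from \<open>B\<close> to \<open>V/B\<close>, and the factor \<open>GL(B)\<close> of the
  stabilizer of the decomposition can normalize \<open>S\<close> arbitrarily.  What is left is the column space of
  \<open>Q\<close> up to \<open>GL(A\<^sub>1) \<times> \<dots> \<times> GL(A\<^sub>r)\<close>, that is, a configuration of type \<open>(a\<^sub>1, \<dots>, a\<^sub>r, b; m)\<close> whose
  first \<open>r\<close> members form a direct sum.  A dense orbit of such configurations therefore gives a dense
  orbit of type \<open>(a\<^sub>1, \<dots>, a\<^sub>r, b, b; n)\<close>.

  The argument is carried out on tuples of basis matrices, with polynomials in the matrix entries
  (\<open>regular\<close> functions).  A dimension vector is dense iff some tuple of injective matrices \<open>M\<^sub>i\<close> is
  \<open>generic_tuple\<close>: a regular function that vanishes at all tuples \<open>g M\<^sub>i h\<^sub>i\<close>, with \<open>g\<close> and the \<open>h\<^sub>i\<close>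
  invertible, vanishes at all tuples (\<open>dense_imp_generic_tuple\<close>, \<open>generic_tuple_imp_dense\<close>).  To pass
  from Pluecker coordinates to matrix entries one works on the affine chart of a nonzero maximal minor
  (\<open>regular_homogenize\<close>).  That a nonempty open condition may be imposed at will is the fact that
  regular functions form an integral domain (\<open>regular_mult_eq_0\<close>).

  Given a regular function \<open>F\<close> that vanishes on the orbit of the candidate \<open>lift_tuple\<close>, the normal form
  above turns \<open>F\<close> into a regular function on the smaller configurations, through \<open>spread_tuple\<close>.
  Multiplied by \<open>det [P\<^sub>1 | \<dots> | P\<^sub>r]\<close>, which is nonzero where the first \<open>r\<close> members form a direct sum, it
  vanishes on the given dense orbit (\<open>spread_orbit\<close>), hence everywhere (\<open>vanishing_spread\<close>), and every
  tuple with a direct sum decomposition and invertible \<open>S\<close> arises in this way (\<open>generic_lift_tuple\<close>).\<close>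

section \<open>Regular functions on tuples of matrices\<close>

definition mat_tuples :: "nat list \<Rightarrow> nat \<Rightarrow> 'a mat list set" where
  "mat_tuples ds n = {Ms. length Ms = length ds \<and> (\<forall>i < length ds. Ms ! i \<in> carrier_mat n (ds ! i))}"

lemma mat_tuplesD:
  assumes "Ms \<in> mat_tuples ds n"
  shows "length Ms = length ds" "\<And>i. i < length ds \<Longrightarrow> Ms ! i \<in> carrier_mat n (ds ! i)"
  using assms by (auto simp: mat_tuples_def)

text \<open>Polynomials in the matrix entries.  By the last rule, regularity depends only on the values at tuples
  of matrices of the right sizes; the entry of a product, for example, is given by the expected formula
  only there.\<close>

inductive regular :: "nat list \<Rightarrow> nat \<Rightarrow> ('a::field mat list \<Rightarrow> 'a) \<Rightarrow> bool" for ds n where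
  const: "regular ds n (\<lambda>_. c)"
| entry: "regular ds n (\<lambda>Ms. Ms ! i $$ (k, l))" if "i < length ds" "k < n" "l < ds ! i"
| add: "regular ds n (\<lambda>Ms. F Ms + G Ms)" if "regular ds n F" "regular ds n G"
| mult: "regular ds n (\<lambda>Ms. F Ms * G Ms)" if "regular ds n F" "regular ds n G"
| cong: "regular ds n G" if "regular ds n F" "\<And>Ms. Ms \<in> mat_tuples ds n \<Longrightarrow> F Ms = G Ms"

lemma regular_sum:
  assumes "\<And>i. i \<in> I \<Longrightarrow> regular ds n (F i)"
  shows "regular ds n (\<lambda>Ms. \<Sum>i\<in>I. F i Ms)"
  using assms by (induction I rule: infinite_finite_induct) (auto intro: regular.intros)

lemma regular_prod:
  assumes "\<And>i. i \<in> I \<Longrightarrow> regular ds n (F i)"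
  shows "regular ds n (\<lambda>Ms. \<Prod>i\<in>I. F i Ms)"
  using assms by (induction I rule: infinite_finite_induct) (auto intro: regular.intros)

lemma regular_compose:
  assumes "regular ds n F"
    and X: "\<And>Ns. Ns \<in> mat_tuples ds' n' \<Longrightarrow> X Ns \<in> mat_tuples ds n"
    and e: "\<And>i k l. \<lbrakk>i < length ds; k < n; l < ds ! i\<rbrakk> \<Longrightarrow> regular ds' n' (\<lambda>Ns. X Ns ! i $$ (k, l))"
  shows "regular ds' n' (\<lambda>Ns. F (X Ns))"
  using assms(1)
proof induction
  case (const c)
  show ?case by (rule regular.const)
next
  case (entry i k l)
  then show ?case by (rule e)
next
  case (add F G)
  then show ?case using regular.add[of ds' n' "\<lambda>Ns. F (X Ns)" "\<lambda>Ns. G (X Ns)"] by simp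
next
  case (mult F G)
  then show ?case using regular.mult[of ds' n' "\<lambda>Ns. F (X Ns)" "\<lambda>Ns. G (X Ns)"] by simp
next
  case (cong F G)
  then show ?case
    using X regular.cong[of ds' n' "\<lambda>Ns. F (X Ns)" "\<lambda>Ns. G (X Ns)"] by simp
qed

definition regular_mat ::
    "nat list \<Rightarrow> nat \<Rightarrow> nat \<Rightarrow> nat \<Rightarrow> ('a::field mat list \<Rightarrow> 'a mat) \<Rightarrow> bool" where
  "regular_mat ds n p q X \<longleftrightarrow> (\<forall>Ms \<in> mat_tuples ds n. X Ms \<in> carrier_mat p q) \<and>
     (\<forall>i < p. \<forall>j < q. regular ds n (\<lambda>Ms. X Ms $$ (i, j)))"

lemma regular_matI:
  assumes "\<And>Ms. Ms \<in> mat_tuples ds n \<Longrightarrow> X Ms \<in> carrier_mat p q"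
    and "\<And>i j. \<lbrakk>i < p; j < q\<rbrakk> \<Longrightarrow> regular ds n (\<lambda>Ms. X Ms $$ (i, j))"
  shows "regular_mat ds n p q X"
  using assms by (auto simp: regular_mat_def)

lemma regular_matD:
  assumes "regular_mat ds n p q X"
  shows "\<And>Ms. Ms \<in> mat_tuples ds n \<Longrightarrow> X Ms \<in> carrier_mat p q"
    and "\<And>i j. \<lbrakk>i < p; j < q\<rbrakk> \<Longrightarrow> regular ds n (\<lambda>Ms. X Ms $$ (i, j))"
  using assms by (auto simp: regular_mat_def)

lemma regular_mat_const: "A \<in> carrier_mat p q \<Longrightarrow> regular_mat ds n p q (\<lambda>_. A)"
  by (auto simp: regular_mat_def intro: regular.const)

lemma regular_mat_component:
  "i < length ds \<Longrightarrow> regular_mat ds n n (ds ! i) (\<lambda>Ms. Ms ! i)"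
  by (auto simp: regular_mat_def mat_tuples_def intro: regular.entry)

lemma regular_mat_mult:
  assumes X: "regular_mat ds n p q X" and Y: "regular_mat ds n q r Y"
  shows "regular_mat ds n p r (\<lambda>Ms. X Ms * Y Ms)"
proof (rule regular_matI)
  show "X Ms * Y Ms \<in> carrier_mat p r" if "Ms \<in> mat_tuples ds n" for Ms
    using regular_matD(1)[OF X that] regular_matD(1)[OF Y that] by simp
  show "regular ds n (\<lambda>Ms. (X Ms * Y Ms) $$ (i, j))" if ij: "i < p" "j < r" for i j
  proof (rule regular.cong)
    show "regular ds n (\<lambda>Ms. \<Sum>k\<in>{0..<q}. X Ms $$ (i, k) * Y Ms $$ (k, j))"
      using ij by (auto intro!: regular_sum regular.mult regular_matD(2)[OF X] regular_matD(2)[OF Y])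
    show "(\<Sum>k\<in>{0..<q}. X Ms $$ (i, k) * Y Ms $$ (k, j)) = (X Ms * Y Ms) $$ (i, j)"
      if "Ms \<in> mat_tuples ds n" for Ms
      using ij regular_matD(1)[OF X that] regular_matD(1)[OF Y that] by (auto simp: scalar_prod_def)
  qed
qed

lemma regular_mat_add:
  assumes X: "regular_mat ds n p q X" and Y: "regular_mat ds n p q Y"
  shows "regular_mat ds n p q (\<lambda>Ms. X Ms + Y Ms)"
proof (rule regular_matI)
  show "X Ms + Y Ms \<in> carrier_mat p q" if "Ms \<in> mat_tuples ds n" for Ms
    using regular_matD(1)[OF Y that] by simp
  show "regular ds n (\<lambda>Ms. (X Ms + Y Ms) $$ (i, j))" if ij: "i < p" "j < q" for i j
  proof (rule regular.cong)
    show "regular ds n (\<lambda>Ms. X Ms $$ (i, j) + Y Ms $$ (i, j))"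
      by (intro regular.add regular_matD(2)[OF X ij] regular_matD(2)[OF Y ij])
    show "X Ms $$ (i, j) + Y Ms $$ (i, j) = (X Ms + Y Ms) $$ (i, j)" if "Ms \<in> mat_tuples ds n" for Ms
      using regular_matD(1)[OF Y that] ij by simp
  qed
qed

lemma regular_mat_entries:
  assumes "\<And>i j. \<lbrakk>i < p; j < q\<rbrakk> \<Longrightarrow> regular ds n (\<lambda>Ms. x Ms i j)"
  shows "regular_mat ds n p q (\<lambda>Ms. mat p q (\<lambda>(i, j). x Ms i j))"
  using assms by (auto intro: regular_matI)

lemma regular_det:
  assumes X: "regular_mat ds n p p X"
  shows "regular ds n (\<lambda>Ms. det (X Ms))"
proof (rule regular.cong)
  show "regular ds n (\<lambda>Ms. \<Sum>\<pi> | \<pi> permutes {0..<p}. signof \<pi> * (\<Prod>i = 0..<p. X Ms $$ (i, \<pi> i)))"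
    by (auto intro!: regular_sum regular.mult regular.const regular_prod regular_matD(2)[OF X]
        dest: permutes_in_image)
  show "(\<Sum>\<pi> | \<pi> permutes {0..<p}. signof \<pi> * (\<Prod>i = 0..<p. X Ms $$ (i, \<pi> i))) = det (X Ms)"
    if "Ms \<in> mat_tuples ds n" for Ms
    using det_def'[OF regular_matD(1)[OF X that]] by simp
qed

lemma regular_mat_delete:
  assumes X: "regular_mat ds n p q X" and "i < p" "j < q"
  shows "regular_mat ds n (p - 1) (q - 1) (\<lambda>Ms. mat_delete (X Ms) i j)"
proof (rule regular_matI)
  show "mat_delete (X Ms) i j \<in> carrier_mat (p - 1) (q - 1)" if "Ms \<in> mat_tuples ds n" for Ms
    using regular_matD(1)[OF X that] by (rule mat_delete_carrier)
  show "regular ds n (\<lambda>Ms. mat_delete (X Ms) i j $$ (k, l))" if kl: "k < p - 1" "l < q - 1" for k l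
  proof (rule regular.cong)
    show "regular ds n (\<lambda>Ms. X Ms $$ (if k < i then k else Suc k, if l < j then l else Suc l))"
      using kl by (auto intro!: regular_matD(2)[OF X])
    show "X Ms $$ (if k < i then k else Suc k, if l < j then l else Suc l)
        = mat_delete (X Ms) i j $$ (k, l)" if "Ms \<in> mat_tuples ds n" for Ms
      using regular_matD(1)[OF X that] kl by (auto simp: mat_delete_def)
  qed
qed

lemma regular_mat_adj:
  assumes X: "regular_mat ds n p p X"
  shows "regular_mat ds n p p (\<lambda>Ms. adj_mat (X Ms))"
proof (rule regular_matI)
  show "adj_mat (X Ms) \<in> carrier_mat p p" if "Ms \<in> mat_tuples ds n" for Ms
    using regular_matD(1)[OF X that] by (rule adj_mat)
  show "regular ds n (\<lambda>Ms. adj_mat (X Ms) $$ (i, j))" if ij: "i < p" "j < p" for i j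
  proof (rule regular.cong)
    show "regular ds n (\<lambda>Ms. (- 1) ^ (j + i) * det (mat_delete (X Ms) j i))"
      by (intro regular.mult regular.const regular_det[where p = "p - 1"]
          regular_mat_delete[OF X] ij)
    show "(- 1) ^ (j + i) * det (mat_delete (X Ms) j i) = adj_mat (X Ms) $$ (i, j)"
      if "Ms \<in> mat_tuples ds n" for Ms
      using regular_matD(1)[OF X that] ij by (simp add: adj_mat_def cofactor_def)
  qed
qed

definition line_tuple :: "'a::field mat list \<Rightarrow> 'a mat list \<Rightarrow> 'a \<Rightarrow> 'a mat list" where
  "line_tuple Ms Ns t = map (\<lambda>i. Ms ! i + t \<cdot>\<^sub>m (Ns ! i - Ms ! i)) [0..<length Ms]"

lemma line_tuple_ends:
  assumes Ms: "Ms \<in> mat_tuples ds n" and Ns: "Ns \<in> mat_tuples ds n"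
  shows "line_tuple Ms Ns 0 = Ms" "line_tuple Ms Ns 1 = Ns"
proof -
  have len: "length Ms = length ds" "length Ns = length ds"
    using mat_tuplesD Ms Ns by auto
  have "line_tuple Ms Ns 0 ! i = Ms ! i" "line_tuple Ms Ns 1 ! i = Ns ! i" if "i < length ds" for i
  proof -
    have "Ms ! i \<in> carrier_mat n (ds ! i)" "Ns ! i \<in> carrier_mat n (ds ! i)"
      using mat_tuplesD(2)[OF Ms that] mat_tuplesD(2)[OF Ns that] .
    then show "line_tuple Ms Ns 0 ! i = Ms ! i" "line_tuple Ms Ns 1 ! i = Ns ! i"
      using that len by (auto simp: line_tuple_def intro!: eq_matI)
  qed
  then show "line_tuple Ms Ns 0 = Ms" "line_tuple Ms Ns 1 = Ns"
    using len by (auto intro!: nth_equalityI simp: line_tuple_def)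
qed

lemma line_tuple_in_mat_tuples:
  assumes "Ms \<in> mat_tuples ds n" "Ns \<in> mat_tuples ds n"
  shows "line_tuple Ms Ns t \<in> mat_tuples ds n"
proof -
  have "Ms ! i + t \<cdot>\<^sub>m (Ns ! i - Ms ! i) \<in> carrier_mat n (ds ! i)" if "i < length ds" for i
    using mat_tuplesD(2)[OF assms(1) that] mat_tuplesD(2)[OF assms(2) that]
    by (meson add_carrier_mat minus_carrier_mat smult_carrier_mat)
  then show ?thesis
    using mat_tuplesD(1)[OF assms(1)] by (auto simp: line_tuple_def mat_tuples_def)
qed

lemma regular_on_line:
  fixes F :: "'a::field mat list \<Rightarrow> 'a"
  assumes "regular ds n F" and Ms: "Ms \<in> mat_tuples ds n" and Ns: "Ns \<in> mat_tuples ds n"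
  shows "\<exists>p. \<forall>t. F (line_tuple Ms Ns t) = poly p t"
  using assms(1)
proof induction
  case (const c)
  show ?case by (rule exI[of _ "[:c:]"]) simp
next
  case (entry i k l)
  then have "Ms ! i \<in> carrier_mat n (ds ! i)" "Ns ! i \<in> carrier_mat n (ds ! i)"
    "i < length Ms"
    using mat_tuplesD[OF Ms] mat_tuplesD[OF Ns] by auto
  then have "\<forall>t. line_tuple Ms Ns t ! i $$ (k, l)
      = poly [:Ms ! i $$ (k, l), Ns ! i $$ (k, l) - Ms ! i $$ (k, l):] t"
    using entry by (auto simp: line_tuple_def)
  then show ?case ..
next
  case (add F G)
  then show ?case by (metis poly_add)
next
  case (mult F G)
  then show ?case by (metis poly_mult)
next
  case (cong F G)
  then show ?case using line_tuple_in_mat_tuples[OF Ms Ns] by metis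
qed

text \<open>Regular functions form an integral domain: on the line through \<open>Ms\<close> and a point with \<open>G \<noteq> 0\<close>, both
  functions become polynomials in one variable, and their product vanishes at infinitely many
  parameters.  In other words, a regular function may be tested on any nonempty principal open set.\<close>

lemma regular_mult_eq_0:
  fixes F G :: "'a::field mat list \<Rightarrow> 'a"
  assumes inf: "infinite (UNIV :: 'a set)"
    and F: "regular ds n F" and G: "regular ds n G"
    and FG: "\<And>Ms. Ms \<in> mat_tuples ds n \<Longrightarrow> G Ms \<noteq> 0 \<Longrightarrow> F Ms = 0"
    and Ns: "Ns \<in> mat_tuples ds n" "G Ns \<noteq> 0"
    and Ms: "Ms \<in> mat_tuples ds n"
  shows "F Ms = 0"
proof -
  obtain p where p: "\<And>t. F (line_tuple Ms Ns t) = poly p t"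
    using regular_on_line[OF F Ms Ns(1)] by blast
  obtain q where q: "\<And>t. G (line_tuple Ms Ns t) = poly q t"
    using regular_on_line[OF G Ms Ns(1)] by blast
  have "poly (p * q) t = 0" for t
    using FG[OF line_tuple_in_mat_tuples[OF Ms Ns(1)], of t] by (auto simp: p q)
  then have "p * q = 0"
    using inf poly_roots_finite[of "p * q"] by auto
  moreover have "poly q 1 \<noteq> 0"
    using q[of 1] Ns line_tuple_ends[OF Ms Ns(1)] by simp
  ultimately have "p = 0" by auto
  then show ?thesis
    using p[of 0] line_tuple_ends[OF Ms Ns(1)] by simp
qed

text \<open>Over a finite field, \<open>1 + \<Prod> (X - a)\<close>, the product running over all elements \<open>a\<close>, has no root.\<close>

lemma infinite_alg_closed_field: "infinite (UNIV :: 'a::alg_closed_field set)"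
proof
  assume fin: "finite (UNIV :: 'a set)"
  define p :: "'a poly" where "p = (\<Prod>a\<in>UNIV. [:- a, 1:])"
  have deg: "degree p = card (UNIV :: 'a set)"
    unfolding p_def by (subst degree_prod_eq_sum_degree) auto
  have "card (UNIV :: 'a set) > 0" using fin by (simp add: card_gt_0_iff)
  then have "degree (p + 1) > 0"
    using deg by (subst degree_add_eq_left) auto
  then obtain x where "poly (p + 1) x = 0" using alg_closed_imp_poly_has_root by blast
  moreover have "poly p x = 0"
    using fin by (simp add: p_def poly_prod)
  ultimately show False by simp
qed

section \<open>Pluecker coordinates and regular functions\<close>

text \<open>The left factor \<open>g\<close> acts on the column spaces, whereas invertible right factors \<open>h i\<close> only change their
  bases.\<close>

definition transform :: "'a::field mat \<Rightarrow> (nat \<Rightarrow> 'a mat) \<Rightarrow> 'a mat list \<Rightarrow> 'a mat list" where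
  "transform g h Ms = map (\<lambda>i. g * Ms ! i * h i) [0..<length Ms]"

definition GL_mat :: "nat \<Rightarrow> 'a::field mat set" where
  "GL_mat n = {g \<in> carrier_mat n n. det g \<noteq> 0}"

lemma length_transform [simp]: "length (transform g h Ms) = length Ms"
  by (simp add: transform_def)

lemma nth_transform [simp]: "i < length Ms \<Longrightarrow> transform g h Ms ! i = g * Ms ! i * h i"
  by (simp add: transform_def)

lemma transform_in_mat_tuples:
  assumes "Ms \<in> mat_tuples ds n" "g \<in> carrier_mat n n"
    and "\<And>i. i < length ds \<Longrightarrow> h i \<in> carrier_mat (ds ! i) (ds ! i)"
  shows "transform g h Ms \<in> mat_tuples ds n"
  using assms by (auto simp: mat_tuples_def intro!: mult_carrier_mat)

lemma submatrix_rows_carrier: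
  assumes "M \<in> carrier_mat n d" "J \<subseteq> {..<n}"
  shows "submatrix M J UNIV \<in> carrier_mat (card J) d"
proof -
  have "{i. i < n \<and> i \<in> J} = J" "{j. j < d \<and> j \<in> UNIV} = {..<d}" using assms by auto
  then show ?thesis using assms by (auto simp: dim_submatrix)
qed

lemma submatrix_rows_index:
  assumes "M \<in> carrier_mat n d" "J \<subseteq> {..<n}" "i < card J" "j < d"
  shows "submatrix M J UNIV $$ (i, j) = M $$ (pick J i, j)" "pick J i < n"
proof -
  have "{i. i < n \<and> i \<in> J} = J" using assms by auto
  then show "submatrix M J UNIV $$ (i, j) = M $$ (pick J i, j)"
    using assms by (auto simp: submatrix_def pick_UNIV)
  show "pick J i < n" using assms pick_in_set_le by blast
qed

lemma submatrix_rows_mult: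
  assumes M: "M \<in> carrier_mat n d" and J: "J \<subseteq> {..<n}" and h: "h \<in> carrier_mat d d"
  shows "submatrix (M * h) J UNIV = submatrix M J UNIV * h"
proof (rule eq_matI)
  have Mh: "M * h \<in> carrier_mat n d" using M h by simp
  note car = submatrix_rows_carrier[OF M J] submatrix_rows_carrier[OF Mh J]
  show "dim_row (submatrix (M * h) J UNIV) = dim_row (submatrix M J UNIV * h)"
    "dim_col (submatrix (M * h) J UNIV) = dim_col (submatrix M J UNIV * h)"
    using car h by auto
  fix i j
  assume "i < dim_row (submatrix M J UNIV * h)" "j < dim_col (submatrix M J UNIV * h)"
  then have ij: "i < card J" "j < d" using car h by auto
  show "submatrix (M * h) J UNIV $$ (i, j) = (submatrix M J UNIV * h) $$ (i, j)"
    using car ij M h submatrix_rows_index[OF M J ij(1)] submatrix_rows_index[OF Mh J ij]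
    by (auto simp: scalar_prod_def intro!: sum.cong)
qed

lemma det_submatrix_rows_mult:
  assumes M: "M \<in> carrier_mat n d" and J: "J \<subseteq> {..<n}" "card J = d" and h: "h \<in> carrier_mat d d"
  shows "det (submatrix (M * h) J UNIV) = det h * det (submatrix M J UNIV)"
  using det_mult[OF submatrix_rows_carrier[OF M J(1), unfolded J(2)] h]
  by (simp add: submatrix_rows_mult[OF M J(1) h])

lemma pick_lessThan:
  assumes "i < d"
  shows "pick {..<d} i = i"
proof -
  have "{a \<in> {..<d}. a < i} = {..<i}" using assms by auto
  then show ?thesis using pick_card_in_set[of i "{..<d}"] assms by simp
qed

text \<open>Matrices whose first \<open>d\<close> rows are the identity represent the affine chart of the Grassmannian on
  which the top maximal minor is nonzero: each subspace in it has exactly one such basis matrix.\<close>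

definition identity_top :: "nat \<Rightarrow> 'a::field mat \<Rightarrow> bool" where
  "identity_top d N \<longleftrightarrow> (\<forall>k < d. \<forall>l < d. N $$ (k, l) = (if k = l then 1 else 0))"

lemma det_top_minor:
  assumes N: "N \<in> carrier_mat n d" and d: "d \<le> n" and "identity_top d N"
  shows "det (submatrix N {..<d} UNIV) = 1"
proof -
  have J: "{..<d} \<subseteq> {..<n}" using d by auto
  have "submatrix N {..<d} UNIV = 1\<^sub>m d"
    using submatrix_rows_carrier[OF N J] submatrix_rows_index[OF N J] assms pick_lessThan
    by (auto intro!: eq_matI simp: identity_top_def)
  then show ?thesis by simp
qed

text \<open>In the chart, the entries are Pluecker coordinates up to sign.  Replacing row \<open>l\<close> of the identity by
  the row \<open>k\<close> below it leaves column \<open>l\<close> with a single nonzero entry, which is in the last row; Laplace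
  expansion along this column gives the minor.\<close>

lemma det_entry_minor:
  assumes N: "N \<in> carrier_mat n d" and top: "identity_top d N"
    and k: "d \<le> k" "k < n" and l: "l < d"
  shows "det (submatrix N (insert k ({..<d} - {l})) UNIV) = (- 1) ^ (d - 1 + l) * N $$ (k, l)"
    and "insert k ({..<d} - {l}) \<subseteq> {..<n}" and "card (insert k ({..<d} - {l})) = d"
proof -
  define J where "J = insert k ({..<d} - {l})"
  show J: "insert k ({..<d} - {l}) \<subseteq> {..<n}" using k l by auto
  show cardJ: "card (insert k ({..<d} - {l})) = d" using k l by simp
  note J = J[folded J_def] and cardJ = cardJ[folded J_def]
  have pick: "pick J i = (if i < l then i else if i < d - 1 then Suc i else k)" if i: "i < d" for i
  proof -
    consider "i < l" | "l \<le> i" "i < d - 1" | "i = d - 1" "l \<le> i" using i by linarith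
    then show ?thesis
    proof cases
      case 1
      have "{a \<in> J. a < i} = {..<i}" using 1 l k by (auto simp: J_def)
      then show ?thesis using pick_card_in_set[of i J] 1 l by (simp add: J_def)
    next
      case 2
      have "{a \<in> J. a < Suc i} = {..<Suc i} - {l}" using 2 l k by (auto simp: J_def)
      then have "card {a \<in> J. a < Suc i} = i" using 2 by simp
      moreover have "Suc i \<in> J" using 2 by (auto simp: J_def)
      ultimately show ?thesis using pick_card_in_set[of "Suc i" J] 2 by simp
    next
      case 3
      have "{a \<in> J. a < k} = {..<d} - {l}" using 3 l k by (auto simp: J_def)
      then have "card {a \<in> J. a < k} = i" using 3 l by simp
      then show ?thesis using pick_card_in_set[of k J] 3 by (simp add: J_def)
    qed
  qed
  define A where "A = submatrix N J UNIV"
  have A: "A \<in> carrier_mat d d"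
    using submatrix_rows_carrier[OF N J] cardJ by (simp add: A_def)
  have A_index: "A $$ (i, j) = N $$ (pick J i, j)" if "i < d" "j < d" for i j
    using submatrix_rows_index[OF N J] that cardJ by (simp add: A_def)
  have "det A = (\<Sum>i<d. A $$ (i, l) * cofactor A i l)"
    by (rule laplace_expansion_column[OF A l])
  also have "\<dots> = (\<Sum>i<d. if i = d - 1 then N $$ (k, l) * cofactor A (d - 1) l else 0)"
    using l top by (intro sum.cong) (auto simp: A_index pick identity_top_def)
  also have "\<dots> = N $$ (k, l) * cofactor A (d - 1) l"
    using l by (subst sum.delta) auto
  also have "mat_delete A (d - 1) l = 1\<^sub>m (d - 1)"
  proof (rule eq_matI)
    fix i j assume "i < dim_row (1\<^sub>m (d - 1) :: 'a mat)" "j < dim_col (1\<^sub>m (d - 1) :: 'a mat)"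
    then have ij: "i < d - 1" "j < d - 1" by auto
    have "mat_delete A (d - 1) l $$ (i, j) = A $$ (i, if j < l then j else Suc j)"
      using ij A l by (auto simp: mat_delete_def)
    also have "\<dots> = (if i = j then 1 else 0)"
      using ij l top by (auto simp: A_index pick identity_top_def)
    finally show "mat_delete A (d - 1) l $$ (i, j) = 1\<^sub>m (d - 1) $$ (i, j)" using ij by simp
  qed (use A in \<open>auto simp: mat_delete_def\<close>)
  then have "cofactor A (d - 1) l = (- 1) ^ (d - 1 + l)"
    by (simp add: cofactor_def)
  finally show "det (submatrix N (insert k ({..<d} - {l})) UNIV) = (- 1) ^ (d - 1 + l) * N $$ (k, l)"
    by (simp add: A_def J_def)
qed

text \<open>A change of the bases multiplies the coordinates of each factor by a common scalar; whether a
  multihomogeneous polynomial vanishes is thus independent of the bases.\<close>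

lemma multihomogeneous_rescale:
  assumes "multihomogeneous ds n e f"
    and "\<And>i J. \<lbrakk>i < length ds; J \<subseteq> {..<n}; card J = ds ! i\<rbrakk> \<Longrightarrow> y (i, J) = c i * x (i, J)"
  shows "f y = (\<Prod>i<length ds. c i ^ e i) * f x"
  using assms(1)
proof induction
  case (const c)
  show ?case by simp
next
  case (coord i J)
  have "(\<Prod>i'<length ds. c i' ^ ((\<lambda>_. 0)(i := 1)) i') = (\<Prod>i'<length ds. if i' = i then c i else 1)"
    by (intro prod.cong) auto
  also have "\<dots> = c i" using coord by (subst prod.delta) auto
  finally show ?case using assms(2) coord by simp
next
  case (add e f g)
  then show ?case by (simp add: algebra_simps)
next
  case (mult e f e' g)
  then show ?case by (simp add: power_add prod.distrib)
qed

lemma multihomogeneous_power: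
  assumes "multihomogeneous ds n e f"
  shows "multihomogeneous ds n (\<lambda>i. N * e i) (\<lambda>x. f x ^ N)"
proof (induction N)
  case 0
  show ?case using multihomogeneous.const[of ds n 1] by simp
next
  case (Suc N)
  then show ?case using multihomogeneous.mult[OF assms Suc] by simp
qed

lemma multihomogeneous_prod_coords:
  assumes "finite I"
    and "\<And>i. i \<in> I \<Longrightarrow> i < length ds \<and> J i \<subseteq> {..<n} \<and> card (J i) = ds ! i"
  shows "multihomogeneous ds n (\<lambda>i. if i \<in> I then 1 else 0)
    (\<lambda>x. \<Prod>i\<in>I. x (i, J i) :: 'a::field)"
  using assms
proof induction
  case empty
  show ?case using multihomogeneous.const[of ds n 1] by simp
next
  case (insert a I)
  have "multihomogeneous ds n ((\<lambda>_. 0)(a := 1)) (\<lambda>x. x (a, J a) :: 'a)"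
    using insert.prems by (intro multihomogeneous.coord) auto
  moreover have "multihomogeneous ds n (\<lambda>i. if i \<in> I then 1 else 0)
    (\<lambda>x. \<Prod>i\<in>I. x (i, J i) :: 'a::field)"
    by (rule insert.IH) (use insert.prems in auto)
  ultimately have "multihomogeneous ds n (\<lambda>i. ((\<lambda>_. 0)(a := 1)) i + (if i \<in> I then 1 else 0))
      (\<lambda>x. x (a, J a) * (\<Prod>i\<in>I. x (i, J i)) :: 'a)"
    by (rule multihomogeneous.mult)
  moreover have "(\<lambda>i. ((\<lambda>_. 0)(a := 1)) i + (if i \<in> I then 1 else 0)) = (\<lambda>i. if i \<in> insert a I then 1 else 0 :: nat)"
    using insert.hyps by auto
  moreover have "(\<lambda>x. x (a, J a) * (\<Prod>i\<in>I. x (i, J i)) :: 'a) = (\<lambda>x. \<Prod>i\<in>insert a I. x (i, J i) :: 'a)"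
    using insert.hyps by simp
  ultimately show ?case by metis
qed

abbreviation equidegree :: "nat list \<Rightarrow> nat \<Rightarrow> nat \<Rightarrow> nat" where
  "equidegree ds N \<equiv> (\<lambda>i. if i < length ds then N else 0)"

text \<open>Applied to the top minors, these products raise the degree in all factors simultaneously.\<close>

lemma multihomogeneous_prod_all_coords:
  assumes "\<And>i. i < length ds \<Longrightarrow> J i \<subseteq> {..<n} \<and> card (J i) = ds ! i"
  shows "multihomogeneous ds n (equidegree ds N) (\<lambda>x. (\<Prod>i<length ds. x (i, J i)) ^ N)"
proof -
  have "multihomogeneous ds n (\<lambda>i. if i \<in> {..<length ds} then 1 else 0) (\<lambda>x. \<Prod>i<length ds. x (i, J i))"
    using assms by (intro multihomogeneous_prod_coords) auto
  from multihomogeneous_power[OF this, of N]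
  have "multihomogeneous ds n (\<lambda>i. N * (if i \<in> {..<length ds} then 1 else 0))
    (\<lambda>x. (\<Prod>i<length ds. x (i, J i)) ^ N)" .
  moreover have "(\<lambda>i. N * (if i \<in> {..<length ds} then 1 else 0)) = equidegree ds N" by auto
  ultimately show ?thesis by simp
qed

lemma multihomogeneous_regular:
  assumes "multihomogeneous ds n e f"
  shows "regular ds n (\<lambda>Ms. f (pluecker Ms))"
  using assms
proof induction
  case (coord i J)
  have "regular_mat ds n (ds ! i) (ds ! i) (\<lambda>Ms. submatrix (Ms ! i) J UNIV)"
  proof (rule regular_matI)
    show "submatrix (Ms ! i) J UNIV \<in> carrier_mat (ds ! i) (ds ! i)" if "Ms \<in> mat_tuples ds n" for Ms
      using submatrix_rows_carrier[OF mat_tuplesD(2)[OF that coord(1)] coord(2)] coord(3) by simp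
    show "regular ds n (\<lambda>Ms. submatrix (Ms ! i) J UNIV $$ (k, l))" if "k < ds ! i" "l < ds ! i" for k l
    proof (rule regular.cong)
      have "pick J k < n" using coord that pick_in_set_le[of k J] by auto
      then show "regular ds n (\<lambda>Ms. Ms ! i $$ (pick J k, l))"
        using coord that by (intro regular.entry)
      show "Ms ! i $$ (pick J k, l) = submatrix (Ms ! i) J UNIV $$ (k, l)" if "Ms \<in> mat_tuples ds n" for Ms
        using submatrix_rows_index(1)[OF mat_tuplesD(2)[OF that coord(1)] coord(2)]
          coord(3) \<open>k < ds ! i\<close> \<open>l < ds ! i\<close> by simp
    qed
  qed
  from regular_det[OF this] show ?case by (simp add: pluecker_def)
next
  case (const c)
  show ?case by (rule regular.const)
next
  case (add e f g)
  show ?case by (rule regular.add[OF add.IH])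
next
  case (mult e f e' g)
  show ?case by (rule regular.mult[OF mult.IH])
qed

definition normalized_tuple :: "nat list \<Rightarrow> 'a::field mat list \<Rightarrow> bool" where
  "normalized_tuple ds Ns \<longleftrightarrow> (\<forall>i < length ds. identity_top (ds ! i) (Ns ! i))"

lemma pluecker_transform_one:
  assumes Ns: "Ns \<in> mat_tuples ds n"
    and h: "\<And>i. i < length ds \<Longrightarrow> h i \<in> carrier_mat (ds ! i) (ds ! i)"
    and i: "i < length ds" and J: "J \<subseteq> {..<n}" "card J = ds ! i"
  shows "pluecker (transform (1\<^sub>m n) h Ns) (i, J) = det (h i) * det (submatrix (Ns ! i) J UNIV)"
proof -
  have "transform (1\<^sub>m n) h Ns ! i = Ns ! i * h i"
    using i mat_tuplesD(1)[OF Ns] left_mult_one_mat[OF mat_tuplesD(2)[OF Ns i]] by simp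
  then show ?thesis
    by (simp add: pluecker_def det_submatrix_rows_mult[OF mat_tuplesD(2)[OF Ns i] J h[OF i]])
qed

text \<open>Every polynomial in the entries of a chart is the dehomogenization of a multihomogeneous polynomial
  in the Pluecker coordinates.  A basis change \<open>h\<close> multiplies all coordinates of the \<open>i\<close>-th factor by
  \<open>det (h i)\<close>, so homogeneity makes the relation hold for all bases of a normalized tuple.  Since the top
  minors equal 1 in the chart, they serve to give all terms the same degree, the same in every factor.\<close>

lemma regular_homogenize:
  fixes F :: "'a::field mat list \<Rightarrow> 'a"
  assumes "regular ds n F" and le: "\<And>i. i < length ds \<Longrightarrow> ds ! i \<le> n"
  shows "\<exists>N f. multihomogeneous ds n (equidegree ds N) f \<and>
    (\<forall>Ns h. Ns \<in> mat_tuples ds n \<longrightarrow> normalized_tuple ds Ns \<longrightarrow>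
      (\<forall>i < length ds. h i \<in> carrier_mat (ds ! i) (ds ! i)) \<longrightarrow>
      f (pluecker (transform (1\<^sub>m n) h Ns)) = (\<Prod>i<length ds. det (h i)) ^ N * F Ns)"
    (is "\<exists>N f. ?P N f F")
  using assms(1)
proof induction
  case (const c)
  have "?P 0 (\<lambda>_. c) (\<lambda>_. c)" using multihomogeneous.const[of ds n c] by simp
  then show ?case by blast
next
  case (entry i k l)
  show ?case
  proof (cases "k < ds ! i")
    case True
    have "?P 0 (\<lambda>_. if k = l then 1 else 0) (\<lambda>Ms. Ms ! i $$ (k, l))"
      using multihomogeneous.const[of ds n "if k = l then 1 else 0"] True entry
      by (auto simp: normalized_tuple_def identity_top_def)
    then show ?thesis by blast
  next
    case False
    define J where "J i' = (if i' = i then insert k ({..<ds ! i} - {l}) else {..<ds ! i'})" for i'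
    define s :: 'a where "s = (- 1) ^ (ds ! i - 1 + l)"
    have s2: "s * s = 1" by (simp add: s_def flip: power_mult_distrib)
    have J: "J i' \<subseteq> {..<n} \<and> card (J i') = ds ! i'" if "i' < length ds" for i'
      using that le[OF that] entry False by (auto simp: J_def)
    \<comment> \<open>The entry is a minor of the \<open>i\<close>-th factor; the top minors of the other factors give degree 1 there.\<close>
    have "multihomogeneous ds n (\<lambda>i. 0 + equidegree ds 1 i) (\<lambda>x. s * (\<Prod>i<length ds. x (i, J i)) ^ 1)"
      by (intro multihomogeneous.mult multihomogeneous.const multihomogeneous_prod_all_coords J)
    moreover have "s * (\<Prod>i'<length ds. pluecker (transform (1\<^sub>m n) h Ns) (i', J i'))
        = (\<Prod>i'<length ds. det (h i')) * (Ns ! i $$ (k, l))"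
      if Ns: "Ns \<in> mat_tuples ds n" "normalized_tuple ds Ns"
        and h: "\<forall>i' < length ds. h i' \<in> carrier_mat (ds ! i') (ds ! i')" for Ns h
    proof -
      have minor: "det (submatrix (Ns ! i') (J i') UNIV) = (if i' = i then s * Ns ! i $$ (k, l) else 1)"
        if i': "i' < length ds" for i'
        using det_top_minor[OF mat_tuplesD(2)[OF Ns(1) i'] le[OF i']] Ns(2) i'
          det_entry_minor(1)[OF mat_tuplesD(2)[OF Ns(1) i'], of k l] entry False
        by (auto simp: normalized_tuple_def J_def s_def)
      have "(\<Prod>i'<length ds. pluecker (transform (1\<^sub>m n) h Ns) (i', J i'))
          = (\<Prod>i'<length ds. det (h i') * (if i' = i then s * Ns ! i $$ (k, l) else 1))"
        using J h by (intro prod.cong) (auto simp: pluecker_transform_one[OF Ns(1)] minor)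
      also have "\<dots> = (\<Prod>i'<length ds. det (h i')) * (s * Ns ! i $$ (k, l))"
        using entry by (simp add: prod.distrib prod.delta)
      finally have "s * (\<Prod>i'<length ds. pluecker (transform (1\<^sub>m n) h Ns) (i', J i'))
          = (s * s) * ((\<Prod>i'<length ds. det (h i')) * (Ns ! i $$ (k, l)))"
        by (simp only: mult_ac)
      then show ?thesis by (simp add: s2)
    qed
    ultimately have "?P 1 (\<lambda>x. s * (\<Prod>i<length ds. x (i, J i)) ^ 1) (\<lambda>Ms. Ms ! i $$ (k, l))"
      by simp
    then show ?thesis by blast
  qed
next
  case (add F G)
  then obtain N f N' f' where f: "?P N f F" and f': "?P N' f' G" by blast
  define q where "q N x = (\<Prod>i<length ds. x (i, {..<ds ! i}) :: 'a) ^ N" for N x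
  have q: "multihomogeneous ds n (equidegree ds N) (q N)" for N
    unfolding q_def using le by (intro multihomogeneous_prod_all_coords) auto
  have eq: "equidegree ds (N + N') = (\<lambda>i. equidegree ds N' i + equidegree ds N i)"
    "equidegree ds (N + N') = (\<lambda>i. equidegree ds N i + equidegree ds N' i)" by auto
  have "multihomogeneous ds n (equidegree ds (N + N')) (\<lambda>x. q N' x * f x)"
    "multihomogeneous ds n (equidegree ds (N + N')) (\<lambda>x. q N x * f' x)"
    using multihomogeneous.mult[OF q conjunct1[OF f], of N']
      multihomogeneous.mult[OF q conjunct1[OF f'], of N]
    by (simp_all flip: eq)
  then have "multihomogeneous ds n (equidegree ds (N + N')) (\<lambda>x. q N' x * f x + q N x * f' x)"
    by (rule multihomogeneous.add)
  moreover have "q N (pluecker (transform (1\<^sub>m n) h Ns)) = (\<Prod>i<length ds. det (h i)) ^ N"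
    if Ns: "Ns \<in> mat_tuples ds n" "normalized_tuple ds Ns"
      and h: "\<forall>i < length ds. h i \<in> carrier_mat (ds ! i) (ds ! i)" for Ns h N
    unfolding q_def
  proof (intro arg_cong[where f = "\<lambda>x. x ^ N"] prod.cong refl)
    fix i assume "i \<in> {..<length ds}"
    then have i: "i < length ds" by simp
    show "pluecker (transform (1\<^sub>m n) h Ns) (i, {..<ds ! i}) = det (h i)"
      using det_top_minor[OF mat_tuplesD(2)[OF Ns(1) i] le[OF i]] Ns(2) i le[OF i] h
      by (subst pluecker_transform_one[OF Ns(1)]) (auto simp: normalized_tuple_def)
  qed
  ultimately have "?P (N + N') (\<lambda>x. q N' x * f x + q N x * f' x) (\<lambda>Ms. F Ms + G Ms)"
    using f f' by (simp add: algebra_simps power_add)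
  then show ?case by blast
next
  case (mult F G)
  then obtain N f N' f' where f: "?P N f F" and f': "?P N' f' G" by blast
  have eq: "equidegree ds (N + N') = (\<lambda>i. equidegree ds N i + equidegree ds N' i)" by auto
  have "multihomogeneous ds n (equidegree ds (N + N')) (\<lambda>x. f x * f' x)"
    unfolding eq by (rule multihomogeneous.mult[OF conjunct1[OF f] conjunct1[OF f']])
  then have "?P (N + N') (\<lambda>x. f x * f' x) (\<lambda>Ms. F Ms * G Ms)"
    using f f' by (simp add: algebra_simps power_add)
  then show ?case by blast
next
  case (cong F G)
  then obtain N f where "?P N f F" by blast
  then have "?P N f G" using cong(2) by simp
  then show ?case by blast
qed

section \<open>Subspaces, bases and the linear groups\<close>

lemma GL_matI: "g \<in> carrier_mat n n \<Longrightarrow> det g \<noteq> 0 \<Longrightarrow> g \<in> GL_mat n"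
  by (simp add: GL_mat_def)

lemma GL_matD: "g \<in> GL_mat n \<Longrightarrow> g \<in> carrier_mat n n" "g \<in> GL_mat n \<Longrightarrow> det g \<noteq> 0"
  by (simp_all add: GL_mat_def)

lemma one_in_GL_mat [simp]: "1\<^sub>m n \<in> GL_mat n"
  by (simp add: GL_mat_def)

lemma mult_in_GL_mat: "g \<in> GL_mat n \<Longrightarrow> h \<in> GL_mat n \<Longrightarrow> g * h \<in> GL_mat n"
  by (auto simp: GL_mat_def det_mult)

lemma smult_in_GL_mat: "g \<in> GL_mat n \<Longrightarrow> c \<noteq> 0 \<Longrightarrow> c \<cdot>\<^sub>m g \<in> GL_mat n"
  by (auto simp: GL_mat_def)

lemma GL_mat_inverse:
  assumes "g \<in> GL_mat n"
  obtains g' where "g' \<in> GL_mat n" "g * g' = 1\<^sub>m n" "g' * g = 1\<^sub>m n"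
proof -
  have "g \<in> Units (ring_mat TYPE('a) n ())"
    using assms by (intro det_non_zero_imp_unit) (auto simp: GL_mat_def)
  then obtain g' where g': "g' \<in> carrier_mat n n" "g * g' = 1\<^sub>m n" "g' * g = 1\<^sub>m n"
    by (auto simp: Units_def ring_mat_simps)
  have "det g * det g' = 1"
    using det_mult[OF GL_matD(1)[OF assms] g'(1)] g'(2) by simp
  then have "det g' \<noteq> 0" by auto
  with g' show thesis by (intro that[of g']) (auto intro: GL_matI)
qed

lemma carrier_GL: "carrier (GL TYPE('a::field) n) = GL_mat n"
proof -
  have "Units (ring_mat TYPE('a) n ()) = GL_mat n"
  proof
    show "Units (ring_mat TYPE('a) n ()) \<subseteq> GL_mat n"
    proof
      fix g :: "'a mat" assume g: "g \<in> Units (ring_mat TYPE('a) n ())"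
      then show "g \<in> GL_mat n"
        using unit_imp_det_non_zero[OF g] by (auto intro!: GL_matI simp: Units_def ring_mat_simps)
    qed
    show "GL_mat n \<subseteq> Units (ring_mat TYPE('a) n ())"
      using det_non_zero_imp_unit by (auto simp: GL_mat_def)
  qed
  then show ?thesis by (simp add: GL_def units_of_def)
qed

text \<open>The coset of \<open>g\<close> modulo the scalar matrices.\<close>

definition PGL_class :: "nat \<Rightarrow> 'a::field mat \<Rightarrow> 'a mat set" where
  "PGL_class n g = {c \<cdot>\<^sub>m g | c. c \<noteq> 0}"

lemma carrier_PGL: "carrier (PGL TYPE('a::field) n) = PGL_class n ` GL_mat n"
proof -
  have "{c \<cdot>\<^sub>m 1\<^sub>m n | c :: 'a. c \<noteq> 0} #>\<^bsub>GL TYPE('a) n\<^esub> g = PGL_class n g" if "g \<in> GL_mat n" for g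
  proof -
    have "(c \<cdot>\<^sub>m 1\<^sub>m n) * g = c \<cdot>\<^sub>m g" for c
 using mult_smult_assoc_mat[OF one_carrier_mat GL_matD(1)[OF that], of c]
      left_mult_one_mat[OF GL_matD(1)[OF that]] by simp
    moreover have "{c \<cdot>\<^sub>m 1\<^sub>m n | c :: 'a. c \<noteq> 0} #>\<^bsub>GL TYPE('a) n\<^esub> g = {c \<cdot>\<^sub>m 1\<^sub>m n * g | c. c \<noteq> 0}"
      by (auto simp: r_coset_def GL_def units_of_def ring_mat_simps)
    ultimately show ?thesis by (simp add: PGL_class_def)
  qed
  then show ?thesis
    by (auto simp: PGL_def FactGroup_def RCOSETS_def carrier_GL)
qed

definition injective_mat :: "nat \<Rightarrow> 'a::field mat \<Rightarrow> bool" where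
  "injective_mat d M \<longleftrightarrow> (\<forall>v \<in> carrier_vec d. M *\<^sub>v v = 0\<^sub>v (dim_row M) \<longrightarrow> v = 0\<^sub>v d)"

lemma assoc_mult_mat_mat_vec:
  assumes "A \<in> carrier_mat n m" "B \<in> carrier_mat m k" "C \<in> carrier_mat k l" "v \<in> carrier_vec l"
  shows "A * B * C *\<^sub>v v = A *\<^sub>v (B *\<^sub>v (C *\<^sub>v v))"
proof -
  have "A * B * C *\<^sub>v v = A * B *\<^sub>v (C *\<^sub>v v)"
    using assms by (intro assoc_mult_mat_vec) auto
  also have "\<dots> = A *\<^sub>v (B *\<^sub>v (C *\<^sub>v v))"
    using assms by (intro assoc_mult_mat_vec mult_mat_vec_carrier) auto
  finally show ?thesis .
qed

lemma injective_mat_mult: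
  assumes "injective_mat d M" "M \<in> carrier_mat n d" "g \<in> GL_mat n" "h \<in> GL_mat d"
  shows "injective_mat d (g * M * h)"
  unfolding injective_mat_def
proof (intro ballI impI)
  fix v :: "'a vec" assume v: "v \<in> carrier_vec d" and "g * M * h *\<^sub>v v = 0\<^sub>v (dim_row (g * M * h))"
  note car = assms(2) GL_matD(1)[OF assms(3)] GL_matD(1)[OF assms(4)]
  have hv: "h *\<^sub>v v \<in> carrier_vec d" using car v by (meson mult_mat_vec_carrier)
  have "g *\<^sub>v (M *\<^sub>v (h *\<^sub>v v)) = g * M * h *\<^sub>v v"
    using assoc_mult_mat_mat_vec[OF car(2) car(1) car(3) v] by simp
  also have "\<dots> = 0\<^sub>v n" using \<open>g * M * h *\<^sub>v v = _\<close> car by simp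
  finally have "g *\<^sub>v (M *\<^sub>v (h *\<^sub>v v)) = 0\<^sub>v n" .
  then have "M *\<^sub>v (h *\<^sub>v v) = 0\<^sub>v n"
    using det_0_iff_vec_prod_zero_field[OF car(2)] GL_matD(2)[OF assms(3)]
      mult_mat_vec_carrier[OF car(1) hv] by blast
  then have "h *\<^sub>v v = 0\<^sub>v d"
    using assms(1) hv car by (auto simp: injective_mat_def)
  then show "v = 0\<^sub>v d"
    using det_0_iff_vec_prod_zero_field[OF car(3)] GL_matD(2)[OF assms(4)] v by auto
qed

lemma identity_top_injective:
  assumes N: "N \<in> carrier_mat n d" and "d \<le> n" and "identity_top d N"
  shows "injective_mat d N"
  unfolding injective_mat_def
proof (intro ballI impI)
  fix v :: "'a vec" assume v: "v \<in> carrier_vec d" and Nv: "N *\<^sub>v v = 0\<^sub>v (dim_row N)"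
  have "v $ k = 0" if k: "k < d" for k
  proof -
    have "(N *\<^sub>v v) $ k = (\<Sum>l\<in>{0..<d}. N $$ (k, l) * v $ l)"
      using N v k assms(2) by (simp add: scalar_prod_def)
    also have "\<dots> = (\<Sum>l\<in>{0..<d}. if l = k then v $ k else 0)"
      using assms(3) k by (intro sum.cong) (auto simp: identity_top_def)
    finally show ?thesis using k Nv N assms(2) by simp
  qed
  then show "v = 0\<^sub>v d" using v by (intro eq_vecI) auto
qed

context vec_space
begin

lemma in_col_space_iff:
  assumes M: "M \<in> carrier_mat n d"
  shows "y \<in> col_space M \<longleftrightarrow> (\<exists>x \<in> carrier_vec d. y = M *\<^sub>v x)"
proof -
  have "dim_row M = n" "dim_col M = d" using M by auto
  then show ?thesis
    using mult_mat_vec_carrier[OF M] by (auto simp: col_space_eq[OF M])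
qed

lemma injective_mat_iff_lin_indpt:
  assumes M: "M \<in> carrier_mat n d"
  shows "injective_mat d M \<longleftrightarrow> distinct (cols M) \<and> lin_indpt (set (cols M))"
proof
  assume inj: "injective_mat d M"
  have "distinct (cols M)"
  proof (rule ccontr)
    assume "\<not> distinct (cols M)"
    then obtain i j where ij: "i \<noteq> j" "cols M ! i = cols M ! j" "i < d" "j < d"
      using M by (auto simp: distinct_conv_nth)
    have "M *\<^sub>v (unit_vec d i - unit_vec d j) = M *\<^sub>v unit_vec d i - M *\<^sub>v unit_vec d j"
      using M by (intro mult_minus_distrib_mat_vec) auto
    also have "\<dots> = 0\<^sub>v n"
    proof -
      have "M *\<^sub>v unit_vec d k = col M k" if "k < d" for k
        using M that by (intro eq_vecI) (auto simp: scalar_prod_right_unit)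
      then show ?thesis using ij M by simp
    qed
    finally have "unit_vec d i - unit_vec d j = (0\<^sub>v d :: 'a vec)"
      using inj M by (auto simp: injective_mat_def)
    then have "(unit_vec d i - unit_vec d j :: 'a vec) $ i = 0" using ij by simp
    then show False using ij by simp
  qed
  moreover have "lin_indpt (set (cols M))"
  proof
    assume "lin_dep (set (cols M))"
    from lin_depE[OF M this \<open>distinct (cols M)\<close>] show False
      using inj M by (auto simp: injective_mat_def)
  qed
  ultimately show "distinct (cols M) \<and> lin_indpt (set (cols M))" ..
next
  assume "distinct (cols M) \<and> lin_indpt (set (cols M))"
  then show "injective_mat d M"
    using lin_depI[OF M] M by (auto simp: injective_mat_def)
qed

text \<open>If \<open>d\<close> columns span a space of dimension \<open>d\<close>, a maximal independent subset of them has \<open>d\<close> elements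
  and so consists of all columns, which are then distinct and independent.\<close>

lemma basis_matrix_iff_injective:
  assumes M: "M \<in> carrier_mat n d"
  shows "basis_matrix d n W M \<longleftrightarrow> injective_mat d M \<and> W = col_space M"
proof
  have cols: "set (cols M) \<subseteq> carrier_vec n" using M cols_dim by blast
  have dim: "vectorspace.dim class_ring (V\<lparr>carrier := col_space M\<rparr>) = rank M"
    by (simp add: rank_def col_space_def)
  show "injective_mat d M \<and> W = col_space M" if "basis_matrix d n W M"
  proof -
    have W: "W = col_space M" and r: "rank M = d"
      using that dim by (auto simp: basis_matrix_def Gr_def)
    obtain S where S: "maximal S (\<lambda>T. T \<subseteq> set (cols M) \<and> lin_indpt T)"
      using maximal_exists_superset[of "set (cols M)" "\<lambda>T. T \<subseteq> set (cols M) \<and> lin_indpt T" "{}"]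
        finite_lin_indpt2[of "{}"] by auto
    have "card S = d" using rank_card_indpt[OF M S] r by simp
    moreover have S': "S \<subseteq> set (cols M)" "lin_indpt S" using S by (auto simp: maximal_def)
    moreover have "card (set (cols M)) \<le> d" using card_length[of "cols M"] M by simp
    ultimately have "card S = card (set (cols M))" "card (set (cols M)) = length (cols M)"
      using M card_mono[OF _ S'(1)] by auto
    moreover from this(1) have "S = set (cols M)"
      using S'(1) by (intro card_subset_eq) auto
    ultimately have "S = set (cols M)" "card (set (cols M)) = length (cols M)" by auto
    then show ?thesis
      using W S'(2) card_distinct injective_mat_iff_lin_indpt[OF M] by blast
  qed
  show "basis_matrix d n W M" if "injective_mat d M \<and> W = col_space M"
  proof -
    have "rank M = d"
      using that injective_mat_iff_lin_indpt[OF M] lin_indpt_full_rank[OF M] by simp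
    then show ?thesis
      using that M dim span_is_subspace[OF cols] by (simp add: basis_matrix_def Gr_def col_space_def)
  qed
qed

text \<open>A maximal independent subset of \<open>W\<close> is finite, as the ambient space has dimension \<open>n\<close>, and spans \<open>W\<close>.\<close>

lemma basis_matrix_exists:
  assumes W: "(W :: 'a vec set) \<in> Gr d n"
  shows "\<exists>M. basis_matrix d n W M"
proof -
  have sub: "VectorSpace.subspace class_ring W V"
    and d: "vectorspace.dim class_ring (V\<lparr>carrier := W\<rparr>) = d"
    using W by (auto simp: Gr_def)
  then have Wn: "W \<subseteq> carrier_vec n" and subm: "LinearCombinations.submodule class_ring W V"
    by (auto simp: subspace_def submodule_def)
  let ?P = "\<lambda>T. T \<subseteq> W \<and> lin_indpt T"
  have "\<exists>U. finite U \<and> maximal U ?P"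
  proof (rule maximal_exists)
    show "finite T \<and> card T \<le> n" if "?P T" for T
      using that Wn li_le_dim[OF fin_dim, of T] dim_is_n by auto
    show "?P {}" using finite_lin_indpt2[of "{}"] by simp
  qed
  then obtain U where U: "finite U" "maximal U ?P" by blast
  then have U': "U \<subseteq> W" "lin_indpt U" by (auto simp: maximal_def)
  have "span U = W"
  proof
    show "span U \<subseteq> W" using span_is_subset[OF U'(1) subm] .
    show "W \<subseteq> span U"
    proof
      fix w assume w: "w \<in> W"
      show "w \<in> span U"
      proof (rule ccontr)
        assume nw: "w \<notin> span U"
        then have "w \<notin> U" using span_mem[of U w] U'(1) Wn by blast
        then have "lin_indpt (U \<union> {w})"
          using lin_dep_iff_in_span[of U w] U' Wn w nw by blast
        then have "U \<union> {w} = U"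
          using U(2) U'(1) w unfolding maximal_def by blast
        then show False using \<open>w \<notin> U\<close> by blast
      qed
    qed
  qed
  obtain us where us: "distinct us" "set us = U" using finite_distinct_list[OF U(1)] by blast
  define M where "M = mat_of_cols n us"
  have M: "M \<in> carrier_mat n (length us)" by (simp add: M_def)
  have cols: "cols M = us"
    using us U'(1) Wn by (simp add: M_def cols_mat_of_cols)
  have "rank M = length us"
    using lin_indpt_full_rank[OF M] us U' cols by simp
  then have "length us = d"
    using d \<open>span U = W\<close> us cols by (simp add: rank_def)
  then have "injective_mat d M"
    using injective_mat_iff_lin_indpt[OF M] us U' cols by simp
  then have "basis_matrix d n W M"
    using basis_matrix_iff_injective[of M d W] M \<open>length us = d\<close> \<open>span U = W\<close> us cols
    by (simp add: col_space_def)
  then show ?thesis ..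
qed

lemma basis_matrix_dim_le:
  assumes "basis_matrix d n (W :: 'a vec set) M"
  shows "d \<le> n"
proof -
  have M: "M \<in> carrier_mat n d" using assms by (simp add: basis_matrix_def)
  then have "distinct (cols M)" "lin_indpt (set (cols M))" "set (cols M) \<subseteq> carrier_vec n"
    using assms basis_matrix_iff_injective injective_mat_iff_lin_indpt cols_dim[of M] by auto
  then show ?thesis
    using li_le_dim(2)[OF fin_dim, of "set (cols M)"] dim_is_n M distinct_card[of "cols M"] by simp
qed

lemma basis_matrix_unique:
  assumes "basis_matrix d n (W :: 'a vec set) M" "basis_matrix d n W M'"
  shows "\<exists>h \<in> GL_mat d. M' = M * h"
proof -
  have M: "M \<in> carrier_mat n d" and M': "M' \<in> carrier_mat n d"
    using assms by (auto simp: basis_matrix_def)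
  have W: "col_space M' = col_space M" and inj: "injective_mat d M'"
    using assms basis_matrix_iff_injective[OF M] basis_matrix_iff_injective[OF M'] by auto
  have "\<exists>x \<in> carrier_vec d. M *\<^sub>v x = col M' j" if j: "j < d" for j
  proof -
    have "set (cols M') \<subseteq> carrier_vec n" using M' cols_dim by blast
    moreover have "col M' j \<in> set (cols M')" using M' j by (auto simp: cols_def)
    ultimately have "col M' j \<in> col_space M'" unfolding col_space_def by (rule span_mem)
    then show ?thesis using W in_col_space_iff[OF M] by metis
  qed
  then obtain x where x: "\<And>j. j < d \<Longrightarrow> x j \<in> carrier_vec d \<and> M *\<^sub>v x j = col M' j" by metis
  define h where "h = mat_of_cols d (map x [0..<d])"
  have h: "h \<in> carrier_mat d d" by (simp add: h_def carrier_matI)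
  have "M' = M * h"
  proof (rule eq_matI)
    fix i j assume "i < dim_row (M * h)" "j < dim_col (M * h)"
    then have ij: "i < n" "j < d" using M h by auto
    have "col h j = x j" using ij x by (simp add: h_def col_mat_of_cols)
    then have "(M * h) $$ (i, j) = (M *\<^sub>v x j) $ i" using ij M h by simp
    then show "M' $$ (i, j) = (M * h) $$ (i, j)" using x ij M' by simp
  qed (use M M' h in auto)
  moreover have "det h \<noteq> 0"
  proof
    assume "det h = 0"
    then obtain v where v: "v \<in> carrier_vec d" "v \<noteq> 0\<^sub>v d" "h *\<^sub>v v = 0\<^sub>v d"
      using det_0_iff_vec_prod_zero_field[OF h] by blast
    have "M' *\<^sub>v v = M *\<^sub>v (h *\<^sub>v v)"
      unfolding \<open>M' = M * h\<close> using M h v by (intro assoc_mult_mat_vec) auto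
    also have "\<dots> = 0\<^sub>v n" using v M by auto
    finally show False using inj v M' by (auto simp: injective_mat_def)
  qed
  ultimately show ?thesis using h by (blast intro: GL_matI)
qed

lemma basis_matrix_translate:
  assumes "basis_matrix d n (W :: 'a vec set) M" and g: "g \<in> GL_mat n" and h: "h \<in> GL_mat d"
  shows "basis_matrix d n (PGL_act (PGL_class n g) W) (g * M * h)"
proof -
  have M: "M \<in> carrier_mat n d" using assms(1) by (simp add: basis_matrix_def)
  note gc = GL_matD(1)[OF g] and hc = GL_matD(1)[OF h]
  have gMh: "g * M * h \<in> carrier_mat n d" using M gc hc by simp
  have inj: "injective_mat d M" and W: "W = col_space M"
    using assms(1) basis_matrix_iff_injective[OF M] by auto
  have act: "(c \<cdot>\<^sub>m g) *\<^sub>v (M *\<^sub>v x) = g *\<^sub>v (M *\<^sub>v (c \<cdot>\<^sub>v x))" if x: "x \<in> carrier_vec d" for c x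
  proof -
    have Mx: "M *\<^sub>v x \<in> carrier_vec n" using M x by (rule mult_mat_vec_carrier)
    have "(c \<cdot>\<^sub>m g) *\<^sub>v (M *\<^sub>v x) = c \<cdot>\<^sub>v (g *\<^sub>v (M *\<^sub>v x))"
    proof (rule eq_vecI)
      fix i assume "i < dim_vec (c \<cdot>\<^sub>v (g *\<^sub>v (M *\<^sub>v x)))"
      then have i: "i < n" using gc by simp
      then show "((c \<cdot>\<^sub>m g) *\<^sub>v (M *\<^sub>v x)) $ i = (c \<cdot>\<^sub>v (g *\<^sub>v (M *\<^sub>v x))) $ i"
        using smult_scalar_prod_distrib[of "row g i" n "M *\<^sub>v x" c] gc Mx by simp
    qed (use gc in auto)
    then show ?thesis using M gc x Mx by (simp add: mult_mat_vec)
  qed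
  have gMhx: "g * M * h *\<^sub>v x = g *\<^sub>v (M *\<^sub>v (h *\<^sub>v x))" if "x \<in> carrier_vec d" for x
    using assoc_mult_mat_mat_vec[OF gc M hc that] .
  obtain h' where h': "h' \<in> GL_mat d" "h * h' = 1\<^sub>m d" using GL_mat_inverse[OF h] by blast
  note h'c = GL_matD(1)[OF h'(1)]
  have hh': "h *\<^sub>v (h' *\<^sub>v x) = x" if "x \<in> carrier_vec d" for x
    using assoc_mult_mat_vec[OF hc h'c that] that h'(2) by simp
  have "PGL_act (PGL_class n g) W = col_space (g * M * h)"
  proof
    show "PGL_act (PGL_class n g) W \<subseteq> col_space (g * M * h)"
    proof
      fix y assume "y \<in> PGL_act (PGL_class n g) W"
      then obtain c x where x: "x \<in> carrier_vec d" "y = (c \<cdot>\<^sub>m g) *\<^sub>v (M *\<^sub>v x)"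
        by (auto simp: W in_col_space_iff[OF M] PGL_act_def PGL_class_def)
      let ?x = "h' *\<^sub>v (c \<cdot>\<^sub>v x)"
      have cx: "c \<cdot>\<^sub>v x \<in> carrier_vec d" using x(1) by simp
      then have x': "?x \<in> carrier_vec d" by (rule mult_mat_vec_carrier[OF h'c])
      have "y = g * M * h *\<^sub>v ?x"
        unfolding x(2) act[OF x(1)] gMhx[OF x'] hh'[OF cx] ..
      then show "y \<in> col_space (g * M * h)"
        using x' in_col_space_iff[OF gMh] by blast
    qed
    show "col_space (g * M * h) \<subseteq> PGL_act (PGL_class n g) W"
    proof
      fix y assume "y \<in> col_space (g * M * h)"
      then obtain x where x: "x \<in> carrier_vec d" "y = g * M * h *\<^sub>v x"
        using in_col_space_iff[OF gMh] by blast
      have hx: "h *\<^sub>v x \<in> carrier_vec d" using hc x(1) by (rule mult_mat_vec_carrier)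
      have "y = (1 \<cdot>\<^sub>m g) *\<^sub>v (M *\<^sub>v (h *\<^sub>v x))"
        unfolding x(2) act[OF hx] gMhx[OF x(1)] one_smult_vec ..
      moreover have "M *\<^sub>v (h *\<^sub>v x) \<in> W"
        using hx W in_col_space_iff[OF M] by blast
      ultimately show "y \<in> PGL_act (PGL_class n g) W"
        by (auto simp: PGL_act_def PGL_class_def intro!: exI[of _ "1 \<cdot>\<^sub>m g"] exI[of _ "1::'a"])
    qed
  qed
  then show ?thesis
    using basis_matrix_iff_injective[OF gMh] injective_mat_mult[OF inj M g h] by simp
qed

end

section \<open>Dense orbits in terms of basis matrices\<close>

lemma transform_transform:
  assumes Ms: "Ms \<in> mat_tuples ds n" and "g \<in> carrier_mat n n" "g' \<in> carrier_mat n n"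
    and h: "\<And>i. i < length ds \<Longrightarrow> h i \<in> carrier_mat (ds ! i) (ds ! i)"
    and h': "\<And>i. i < length ds \<Longrightarrow> h' i \<in> carrier_mat (ds ! i) (ds ! i)"
  shows "transform g h (transform g' h' Ms) = transform (g * g') (\<lambda>i. h' i * h i) Ms"
proof (rule nth_equalityI)
  fix i assume "i < length (transform g h (transform g' h' Ms))"
  then have i: "i < length ds" and i': "i < length Ms" using mat_tuplesD(1)[OF Ms] by auto
  note M = mat_tuplesD(2)[OF Ms i] and hi = h[OF i] h'[OF i]
  have g'M: "g' * Ms ! i \<in> carrier_mat n (ds ! i)" using assms(3) M by simp
  have "g * (g' * Ms ! i * h' i) * h i = g * (g' * Ms ! i) * h' i * h i"
    using assoc_mult_mat[OF assms(2) g'M hi(2)] by simp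
  also have "\<dots> = g * (g' * Ms ! i) * (h' i * h i)"
    using assms(2) g'M hi by (intro assoc_mult_mat[of _ n "ds ! i"]) auto
  also have "g * (g' * Ms ! i) = g * g' * Ms ! i"
    using assoc_mult_mat[OF assms(2,3) M] by simp
  finally show "transform g h (transform g' h' Ms) ! i = transform (g * g') (\<lambda>i. h' i * h i) Ms ! i"
    using i' by simp
qed simp

lemma transform_one:
  assumes Ms: "Ms \<in> mat_tuples ds n"
    and h: "\<And>i. i < length ds \<Longrightarrow> h i = 1\<^sub>m (ds ! i)"
  shows "transform (1\<^sub>m n) h Ms = Ms"
proof (rule nth_equalityI)
  fix i assume "i < length (transform (1\<^sub>m n) h Ms)"
  then have i: "i < length ds" and i': "i < length Ms" using mat_tuplesD(1)[OF Ms] by auto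
  show "transform (1\<^sub>m n) h Ms ! i = Ms ! i"
    using i' mat_tuplesD(2)[OF Ms i] h[OF i] by simp
qed simp

lemma regular_transform:
  assumes "regular ds n F" and g: "g \<in> carrier_mat n n"
    and h: "\<And>i. i < length ds \<Longrightarrow> h i \<in> carrier_mat (ds ! i) (ds ! i)"
  shows "regular ds n (\<lambda>Ms. F (transform g h Ms))"
  using assms(1)
proof (rule regular_compose)
  show "transform g h Ns \<in> mat_tuples ds n" if "Ns \<in> mat_tuples ds n" for Ns
    using that g h by (rule transform_in_mat_tuples)
  show "regular ds n (\<lambda>Ns. transform g h Ns ! i $$ (k, l))"
    if i: "i < length ds" and kl: "k < n" "l < ds ! i" for i k l
  proof (rule regular.cong)
    have "regular_mat ds n n (ds ! i) (\<lambda>Ns. g * Ns ! i * h i)"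
      using i h[OF i] g
      by (intro regular_mat_mult[where q = "ds ! i"] regular_mat_mult[where q = n]
          regular_mat_const regular_mat_component)
    then show "regular ds n (\<lambda>Ns. (g * Ns ! i * h i) $$ (k, l))" using kl by (rule regular_matD)
    show "(g * Ns ! i * h i) $$ (k, l) = transform g h Ns ! i $$ (k, l)"
      if "Ns \<in> mat_tuples ds n" for Ns
      using i mat_tuplesD(1)[OF that] by simp
  qed
qed

text \<open>The possible right factors in \<open>transform\<close>.\<close>

definition base_changes :: "nat list \<Rightarrow> (nat \<Rightarrow> 'a::field mat) set" where
  "base_changes ds = {h. \<forall>i < length ds. h i \<in> GL_mat (ds ! i)}"

lemma base_changesD: "h \<in> base_changes ds \<Longrightarrow> i < length ds \<Longrightarrow> h i \<in> GL_mat (ds ! i)"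
  by (simp add: base_changes_def)

lemma normalize_tuple:
  fixes Ns :: "'a::field mat list"
  assumes Ns: "Ns \<in> mat_tuples ds n" and le: "\<And>i. i < length ds \<Longrightarrow> ds ! i \<le> n"
    and det: "\<And>i. i < length ds \<Longrightarrow> det (submatrix (Ns ! i) {..<ds ! i} UNIV) \<noteq> 0"
  obtains Ns' T S where "Ns' \<in> mat_tuples ds n" "normalized_tuple ds Ns'"
    "T \<in> base_changes ds" "S \<in> base_changes ds"
    "Ns = transform (1\<^sub>m n) T Ns'" "Ns' = transform (1\<^sub>m n) S Ns"
proof -
  define T where "T i = submatrix (Ns ! i) {..<ds ! i} UNIV" for i
  have T: "T i \<in> GL_mat (ds ! i)" if "i < length ds" for i
    using submatrix_rows_carrier[OF mat_tuplesD(2)[OF Ns that], of "{..<ds ! i}"] det[OF that] le[OF that]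
    by (auto simp: T_def intro: GL_matI)
  have "\<forall>i < length ds. \<exists>S. S \<in> GL_mat (ds ! i) \<and> T i * S = 1\<^sub>m (ds ! i) \<and> S * T i = 1\<^sub>m (ds ! i)"
    using T by (meson GL_mat_inverse)
  then obtain S where S: "\<And>i. i < length ds \<Longrightarrow> S i \<in> GL_mat (ds ! i)"
    "\<And>i. i < length ds \<Longrightarrow> T i * S i = 1\<^sub>m (ds ! i)" "\<And>i. i < length ds \<Longrightarrow> S i * T i = 1\<^sub>m (ds ! i)"
    by metis
  define Ns' where "Ns' = transform (1\<^sub>m n) S Ns"
  note Tc = GL_matD(1)[OF T] and Sc = GL_matD(1)[OF S(1)]
  have Ns': "Ns' \<in> mat_tuples ds n"
    unfolding Ns'_def using Ns Sc by (intro transform_in_mat_tuples) auto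
  have norm: "normalized_tuple ds Ns'"
    unfolding normalized_tuple_def identity_top_def
  proof (intro allI impI)
    fix i k l assume i: "i < length ds" and kl: "k < ds ! i" "l < ds ! i"
    have J: "{..<ds ! i} \<subseteq> {..<n}" using le[OF i] by auto
    have Ns'i: "Ns' ! i = Ns ! i * S i"
      using i mat_tuplesD(1)[OF Ns] left_mult_one_mat[OF mat_tuplesD(2)[OF Ns i]]
      by (simp add: Ns'_def)
    have "Ns' ! i $$ (k, l) = submatrix (Ns' ! i) {..<ds ! i} UNIV $$ (k, l)"
      using submatrix_rows_index(1)[OF mat_tuplesD(2)[OF Ns' i] J] kl by (simp add: pick_lessThan)
    also have "\<dots> = 1\<^sub>m (ds ! i) $$ (k, l)"
      using submatrix_rows_mult[OF mat_tuplesD(2)[OF Ns i] J Sc[OF i]] S(2)[OF i] Ns'i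
      by (simp add: T_def)
    finally show "Ns' ! i $$ (k, l) = (if k = l then 1 else 0)" using kl by simp
  qed
  have Ns_eq: "transform (1\<^sub>m n) T Ns' = Ns"
  proof -
    have "transform (1\<^sub>m n) T Ns' = transform (1\<^sub>m n * 1\<^sub>m n) (\<lambda>i. S i * T i) Ns"
      unfolding Ns'_def by (rule transform_transform[OF Ns one_carrier_mat one_carrier_mat Tc Sc])
    also have "1\<^sub>m n * 1\<^sub>m n = (1\<^sub>m n :: 'a mat)" by (rule left_mult_one_mat[OF one_carrier_mat])
    also have "transform (1\<^sub>m n) (\<lambda>i. S i * T i) Ns = Ns" by (rule transform_one[OF Ns S(3)])
    finally show ?thesis .
  qed
  have "T \<in> base_changes ds" "S \<in> base_changes ds" using T S(1) by (simp_all add: base_changes_def)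
  from that[OF Ns' norm this Ns_eq[symmetric] Ns'_def] show thesis .
qed

text \<open>Zariski density of the orbit, phrased with matrices instead of subspaces and with arbitrary
  polynomials in their entries instead of multihomogeneous polynomials in Pluecker coordinates.\<close>

definition generic_tuple :: "nat list \<Rightarrow> nat \<Rightarrow> 'a::field mat list \<Rightarrow> bool" where
  "generic_tuple ds n Ms \<longleftrightarrow> (\<forall>F. regular ds n F \<longrightarrow>
     (\<forall>g \<in> GL_mat n. \<forall>h \<in> base_changes ds. F (transform g h Ms) = 0) \<longrightarrow>
     (\<forall>Ns \<in> mat_tuples ds n. F Ns = 0))"

lemma basis_matricesD:
  assumes "basis_matrices ds n Ws Ms"
  shows "length Ws = length ds" "Ms \<in> mat_tuples ds n" "Ws \<in> Gr_prod ds n"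
    "\<And>i. i < length ds \<Longrightarrow> basis_matrix (ds ! i) n (Ws ! i) (Ms ! i)"
  using assms by (auto simp: basis_matrices_def basis_matrix_def mat_tuples_def Gr_prod_def)

lemma basis_matrices_exist:
  assumes "Ws \<in> Gr_prod ds n"
  shows "\<exists>Ms. basis_matrices ds n Ws Ms"
proof -
  have "\<forall>i < length ds. \<exists>M. basis_matrix (ds ! i) n (Ws ! i) M"
  proof (intro allI impI vec_space.basis_matrix_exists)
    show "Ws ! i \<in> Gr (ds ! i) n" if "i < length ds" for i using assms that by (simp add: Gr_prod_def)
  qed
  then obtain M where "\<And>i. i < length ds \<Longrightarrow> basis_matrix (ds ! i) n (Ws ! i) (M i)" by metis
  then have "basis_matrices ds n Ws (map M [0..<length ds])"
    using assms by (auto simp: basis_matrices_def Gr_prod_def)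
  then show ?thesis ..
qed

lemma basis_matrices_unique:
  assumes Ms: "basis_matrices ds n Ws Ms" and Ms': "basis_matrices ds n Ws Ms'"
  shows "\<exists>h \<in> base_changes ds. Ms' = transform (1\<^sub>m n) h Ms"
proof -
  have "\<forall>i < length ds. \<exists>h \<in> GL_mat (ds ! i). Ms' ! i = Ms ! i * h"
    using basis_matricesD(4)[OF Ms] basis_matricesD(4)[OF Ms'] vec_space.basis_matrix_unique by blast
  then obtain h where h: "\<And>i. i < length ds \<Longrightarrow> h i \<in> GL_mat (ds ! i) \<and> Ms' ! i = Ms ! i * h i"
    by metis
  have len: "length Ms = length ds" "length Ms' = length ds"
    using Ms Ms' by (simp_all add: basis_matrices_def)
  have "Ms' = transform (1\<^sub>m n) h Ms"
  proof (rule nth_equalityI)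
    show "length Ms' = length (transform (1\<^sub>m n) h Ms)"
      using len by simp
    fix i assume "i < length Ms'"
    then have i: "i < length ds" "i < length Ms" using len by simp_all
    show "Ms' ! i = transform (1\<^sub>m n) h Ms ! i"
      using i h left_mult_one_mat[OF mat_tuplesD(2)[OF basis_matricesD(2)[OF Ms] i(1)]] by simp
  qed
  then show ?thesis using h by (auto simp: base_changes_def)
qed

lemma basis_matrices_translate:
  assumes Ms: "basis_matrices ds n Ws Ms" and g: "g \<in> GL_mat n" and h: "h \<in> base_changes ds"
  shows "basis_matrices ds n (map (PGL_act (PGL_class n g)) Ws) (transform g h Ms)"
  unfolding basis_matrices_def
proof (intro conjI allI impI)
  have len: "length Ms = length ds" "length Ws = length ds" using Ms by (auto simp: basis_matrices_def)
  then show "length (map (PGL_act (PGL_class n g)) Ws) = length ds" "length (transform g h Ms) = length ds"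
    by auto
  fix i assume i: "i < length ds"
  show "basis_matrix (ds ! i) n (map (PGL_act (PGL_class n g)) Ws ! i) (transform g h Ms ! i)"
    using vec_space.basis_matrix_translate[OF basis_matricesD(4)[OF Ms i] g base_changesD[OF h i]] i len
    by simp
qed

lemma PGL_orbit_eq: "PGL_orbit n (Ws :: 'a::field vec set list)
    = (\<lambda>g. map (PGL_act (PGL_class n g)) Ws) ` GL_mat n"
  by (auto simp: PGL_orbit_def carrier_PGL)

lemma basis_matrices_rescale:
  assumes f: "multihomogeneous ds n e f"
    and Ms: "basis_matrices ds n Ws Ms" and Ms': "basis_matrices ds n Ws Ms'"
    and "f (pluecker Ms') \<noteq> 0"
  shows "f (pluecker Ms) \<noteq> 0"
proof -
  obtain h where h: "h \<in> base_changes ds" and eq: "Ms' = transform (1\<^sub>m n) h Ms"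
    using basis_matrices_unique[OF Ms Ms'] by blast
  have "pluecker Ms' (i, J) = det (h i) * pluecker Ms (i, J)"
    if "i < length ds" "J \<subseteq> {..<n}" "card J = ds ! i" for i J
    unfolding eq using that GL_matD(1)[OF base_changesD[OF h]]
    by (subst pluecker_transform_one[OF basis_matricesD(2)[OF Ms]]) (auto simp: pluecker_def)
  then have "f (pluecker Ms') = (\<Prod>i<length ds. det (h i) ^ e i) * f (pluecker Ms)"
    by (rule multihomogeneous_rescale[OF f])
  then show ?thesis using assms(4) by auto
qed

text \<open>The generating open sets form a basis of the topology.  For the intersection of two of them, both
  polynomials have to be nonzero at the same basis matrices, which rescaling provides.\<close>

lemma generate_zariski_basis:
  assumes "generate_topology_on {Gr_prod ds n - zero_locus ds n f | e f. multihomogeneous ds n e f} U"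
    and "Ws \<in> U"
  shows "\<exists>e f. multihomogeneous ds n e f \<and> Ws \<in> Gr_prod ds n - zero_locus ds n f \<and>
    Gr_prod ds n - zero_locus ds n f \<subseteq> U"
  using assms
proof induction
  case Empty
  then show ?case by simp
next
  case (Int A B)
  then obtain e f e' f' where f: "multihomogeneous ds n e f" "Ws \<in> Gr_prod ds n - zero_locus ds n f"
      "Gr_prod ds n - zero_locus ds n f \<subseteq> A"
    and f': "multihomogeneous ds n e' f'" "Ws \<in> Gr_prod ds n - zero_locus ds n f'"
      "Gr_prod ds n - zero_locus ds n f' \<subseteq> B" by blast
  obtain Ms where Ms: "basis_matrices ds n Ws Ms" "f (pluecker Ms) \<noteq> 0"
    using f(2) by (auto simp: zero_locus_def)
  obtain Ms' where Ms': "basis_matrices ds n Ws Ms'" "f' (pluecker Ms') \<noteq> 0"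
    using f'(2) by (auto simp: zero_locus_def)
  have "f (pluecker Ms) * f' (pluecker Ms) \<noteq> 0"
    using basis_matrices_rescale[OF f'(1) Ms(1) Ms'] Ms(2) by simp
  then have "Ws \<in> Gr_prod ds n - zero_locus ds n (\<lambda>x. f x * f' x)"
    using Ms(1) f(2) by (auto simp: zero_locus_def)
  moreover have "Gr_prod ds n - zero_locus ds n (\<lambda>x. f x * f' x) \<subseteq> A \<inter> B"
    using f(3) f'(3) by (auto simp: zero_locus_def)
  ultimately show ?case using multihomogeneous.mult[OF f(1) f'(1)] by blast
next
  case (UN K)
  then obtain k where "k \<in> K" "Ws \<in> k" by blast
  with UN.IH show ?case by blast
next
  case (Basis S)
  then show ?case by blast
qed

lemma topspace_zariski: "topspace (zariski ds n :: 'a::field vec set list topology) = Gr_prod ds n"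
proof -
  have "zero_locus ds n (\<lambda>_. 1 :: 'a) = {}"
    using basis_matrices_exist by (auto simp: zero_locus_def)
  then have "Gr_prod ds n \<in> {Gr_prod ds n - zero_locus ds n f | e (f :: _ \<Rightarrow> 'a). multihomogeneous ds n e f}"
    using multihomogeneous.const[of ds n "1 :: 'a"] by blast
  then show ?thesis by (auto simp: zariski_def)
qed

text \<open>A polynomial in Pluecker coordinates is a regular function of the basis matrices.  If it is nonzero
  somewhere, genericity makes it nonzero at some point of the orbit; hence the orbit meets every
  nonempty basic open set.\<close>

lemma generic_tuple_imp_dense:
  fixes Ms :: "'a::field mat list"
  assumes Ms: "Ms \<in> mat_tuples ds n" and gen: "generic_tuple ds n Ms"
    and inj: "\<And>i. i < length ds \<Longrightarrow> injective_mat (ds ! i) (Ms ! i)"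
  shows "dense_dim_vector TYPE('a) ds n"
proof -
  define Ws where "Ws = map (vec_space.col_space n) Ms"
  have bas: "basis_matrices ds n Ws Ms"
    unfolding basis_matrices_def
    using mat_tuplesD[OF Ms] inj by (auto simp: Ws_def vec_space.basis_matrix_iff_injective)
  have "Vs \<in> zariski ds n closure_of PGL_orbit n Ws" if Vs: "Vs \<in> Gr_prod ds n" for Vs
    unfolding in_closure_of
  proof (intro conjI allI impI)
    show "Vs \<in> topspace (zariski ds n)" using Vs by (simp add: topspace_zariski)
    fix U assume "Vs \<in> U \<and> openin (zariski ds n) U"
    then obtain e f where f: "multihomogeneous ds n e f" "Vs \<in> Gr_prod ds n - zero_locus ds n f"
      "Gr_prod ds n - zero_locus ds n f \<subseteq> U"
      using generate_zariski_basis[of ds n U Vs]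
      by (auto simp: zariski_def openin_topology_generated_by_iff)
    obtain Ns where Ns: "basis_matrices ds n Vs Ns" "f (pluecker Ns) \<noteq> 0"
      using f(2) by (auto simp: zero_locus_def)
    then have "\<exists>Ns \<in> mat_tuples ds n. f (pluecker Ns) \<noteq> 0"
      using basis_matricesD(2) by blast
    then obtain g h where gh: "g \<in> GL_mat n" "h \<in> base_changes ds" "f (pluecker (transform g h Ms)) \<noteq> 0"
      using gen multihomogeneous_regular[OF f(1)] unfolding generic_tuple_def by blast
    define Y where "Y = map (PGL_act (PGL_class n g)) Ws"
    have Y: "basis_matrices ds n Y (transform g h Ms)"
      unfolding Y_def by (rule basis_matrices_translate[OF bas gh(1,2)])
    then have "Y \<in> Gr_prod ds n - zero_locus ds n f"
      using gh(3) basis_matricesD(3)[OF Y] by (auto simp: zero_locus_def)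
    moreover have "Y \<in> PGL_orbit n Ws" using gh(1) by (auto simp: Y_def PGL_orbit_eq)
    ultimately show "\<exists>Y. Y \<in> PGL_orbit n Ws \<and> Y \<in> U" using f(3) by blast
  qed
  moreover have "zariski ds n closure_of PGL_orbit n Ws \<subseteq> Gr_prod ds n"
    using closure_of_subset_topspace[of "zariski ds n :: 'a vec set list topology"]
    by (simp add: topspace_zariski)
  ultimately show ?thesis
    using basis_matricesD(3)[OF bas] unfolding dense_dim_vector_def by blast
qed

text \<open>Otherwise the complement of the zero locus of \<open>f\<close> would be a nonempty open set that misses the orbit.\<close>

lemma dense_orbit_zero_locus:
  assumes dense: "zariski ds n closure_of PGL_orbit n Ws = Gr_prod ds n"
    and Ms: "basis_matrices ds n Ws Ms" and f: "multihomogeneous ds n e f"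
    and van: "\<And>g h. g \<in> GL_mat n \<Longrightarrow> h \<in> base_changes ds \<Longrightarrow> f (pluecker (transform g h Ms)) = 0"
    and Ns: "basis_matrices ds n Vs Ns"
  shows "f (pluecker Ns) = 0"
proof (rule ccontr)
  assume "f (pluecker Ns) \<noteq> 0"
  then have Vs: "Vs \<in> Gr_prod ds n - zero_locus ds n f"
    using Ns basis_matricesD(3)[OF Ns] by (auto simp: zero_locus_def)
  have "openin (zariski ds n) (Gr_prod ds n - zero_locus ds n f)"
    unfolding zariski_def using f by (intro topology_generated_by_Basis) blast
  moreover have "Vs \<in> zariski ds n closure_of PGL_orbit n Ws" using Vs dense by simp
  ultimately obtain Y where Y: "Y \<in> PGL_orbit n Ws" "Y \<in> Gr_prod ds n - zero_locus ds n f"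
    using Vs unfolding in_closure_of by blast
  obtain g where g: "g \<in> GL_mat n" "Y = map (PGL_act (PGL_class n g)) Ws"
    using Y(1) by (auto simp: PGL_orbit_eq)
  obtain Ys where Ys: "basis_matrices ds n Y Ys" "f (pluecker Ys) \<noteq> 0"
    using Y(2) by (auto simp: zero_locus_def)
  have one: "(\<lambda>i. 1\<^sub>m (ds ! i)) \<in> base_changes ds" by (simp add: base_changes_def)
  have "f (pluecker (transform g (\<lambda>i. 1\<^sub>m (ds ! i)) Ms)) \<noteq> 0"
    using basis_matrices_rescale[OF f basis_matrices_translate[OF Ms g(1) one] Ys(1)[unfolded g(2)] Ys(2)] .
  then show False using van[OF g(1) one] by simp
qed

text \<open>The topology only sees subspaces, whereas \<open>F\<close> depends on bases.  For fixed basis changes \<open>T\<close>, the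
  function \<open>Ns \<mapsto> F (Ns T)\<close> of normalized tuples is homogenized to a polynomial in Pluecker coordinates,
  which vanishes at the part of the orbit inside the chart; an additional factor makes it vanish at the
  rest of the orbit.  By density it vanishes everywhere, so \<open>F\<close> vanishes at \<open>Ns T\<close> for all normalized
  \<open>Ns\<close> and all \<open>T\<close>, that is, wherever the top minors are nonzero.  This open
  condition suffices by \<open>regular_mult_eq_0\<close>.\<close>

lemma dense_imp_generic_tuple:
  assumes inf: "infinite (UNIV :: 'a::field set)"
    and dense: "dense_dim_vector TYPE('a) ds n"
  shows "\<exists>Ms \<in> mat_tuples ds n. generic_tuple ds n (Ms :: 'a mat list)
    \<and> (\<forall>i < length ds. injective_mat (ds ! i) (Ms ! i))"
proof -
  obtain Ws :: "'a vec set list" where Ws: "Ws \<in> Gr_prod ds n"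
    "zariski ds n closure_of PGL_orbit n Ws = Gr_prod ds n"
    using dense by (auto simp: dense_dim_vector_def)
  obtain Ms where bas: "basis_matrices ds n Ws Ms" using basis_matrices_exist[OF Ws(1)] by blast
  have Ms: "Ms \<in> mat_tuples ds n" using basis_matricesD(2)[OF bas] .
  have le: "ds ! i \<le> n" if i: "i < length ds" for i
    using vec_space.basis_matrix_dim_le[OF basis_matricesD(4)[OF bas i]] .
  have inj: "\<forall>i < length ds. injective_mat (ds ! i) (Ms ! i)"
    using basis_matricesD(4)[OF bas] vec_space.basis_matrix_iff_injective[OF mat_tuplesD(2)[OF Ms]]
    by blast
  have "F Ns = 0"
    if F: "regular ds n F" and van: "\<And>g h. g \<in> GL_mat n \<Longrightarrow> h \<in> base_changes ds \<Longrightarrow> F (transform g h Ms) = 0"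
      and Ns: "Ns \<in> mat_tuples ds n" for F Ns
  proof -
    define top where "top Ns i = det (submatrix (Ns ! i) {..<ds ! i} UNIV)" for Ns :: "'a mat list" and i
    have top1: "top Ns i = 1" if "normalized_tuple ds Ns" "Ns \<in> mat_tuples ds n" "i < length ds" for Ns i
      using det_top_minor[OF mat_tuplesD(2)[OF that(2,3)] le[OF that(3)]] that
      by (simp add: top_def normalized_tuple_def)
    have multihom_top: "multihomogeneous ds n (equidegree ds 1)
        (\<lambda>x. (\<Prod>i<length ds. x (i, {..<ds ! i}) :: 'a) ^ 1)"
      using le by (intro multihomogeneous_prod_all_coords) auto
    have top_pluecker: "(\<Prod>i<length ds. pluecker Ns (i, {..<ds ! i})) = (\<Prod>i<length ds. top Ns i)" for Ns :: "'a mat list"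
      by (simp add: top_def pluecker_def)
    have normalized: "F (transform (1\<^sub>m n) T Ns) = 0"
      if T: "T \<in> base_changes ds" and Ns: "Ns \<in> mat_tuples ds n" "normalized_tuple ds Ns" for T Ns
    proof -
      note Tc = GL_matD(1)[OF base_changesD[OF T]]
      have "regular ds n (\<lambda>Ms. F (transform (1\<^sub>m n) T Ms))"
        by (rule regular_transform[OF F one_carrier_mat Tc])
      from regular_homogenize[OF this le] obtain N f where
        f: "multihomogeneous ds n (equidegree ds N) f" and
        f_eq: "\<And>Ns h. \<lbrakk>Ns \<in> mat_tuples ds n; normalized_tuple ds Ns;
          \<forall>i < length ds. h i \<in> carrier_mat (ds ! i) (ds ! i)\<rbrakk> \<Longrightarrow>
          f (pluecker (transform (1\<^sub>m n) h Ns)) = (\<Prod>i<length ds. det (h i)) ^ N * F (transform (1\<^sub>m n) T Ns)"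
        by blast
      \<comment> \<open>Outside the chart \<open>f\<close> is not controlled; the product of the top minors vanishes there.\<close>
      define f' where "f' x = f x * (\<Prod>i<length ds. x (i, {..<ds ! i})) ^ 1" for x
      have f': "multihomogeneous ds n (\<lambda>i. equidegree ds N i + equidegree ds 1 i) f'"
        unfolding f'_def by (rule multihomogeneous.mult[OF f multihom_top])
      have f'_top: "f' (pluecker Ns) = f (pluecker Ns) * (\<Prod>i<length ds. top Ns i)" for Ns
        by (simp add: f'_def top_pluecker)
      have "f' (pluecker (transform g h Ms)) = 0" if g: "g \<in> GL_mat n" and h: "h \<in> base_changes ds" for g h
      proof (cases "\<forall>i < length ds. top (transform g h Ms) i \<noteq> 0")
        case False
        then have "(\<Prod>i<length ds. top (transform g h Ms) i) = 0" by (intro prod_zero) auto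
        then show ?thesis by (simp add: f'_top)
      next
        case True
        note gc = GL_matD(1)[OF g] and hc = GL_matD(1)[OF base_changesD[OF h]]
        have X: "transform g h Ms \<in> mat_tuples ds n"
          by (rule transform_in_mat_tuples[OF Ms gc hc])
        have det: "det (submatrix (transform g h Ms ! i) {..<ds ! i} UNIV) \<noteq> 0" if "i < length ds" for i
          using True that by (simp add: top_def)
        obtain X' T' S where X': "X' \<in> mat_tuples ds n" "normalized_tuple ds X'"
          and T': "T' \<in> base_changes ds" and S: "S \<in> base_changes ds"
          and eqs: "transform g h Ms = transform (1\<^sub>m n) T' X'"
            "X' = transform (1\<^sub>m n) S (transform g h Ms)"
          using normalize_tuple[OF X le det] by blast
        note Sc = GL_matD(1)[OF base_changesD[OF S]]
        have "transform (1\<^sub>m n) T X'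
            = transform (1\<^sub>m n * 1\<^sub>m n) (\<lambda>i. S i * T i) (transform g h Ms)"
          unfolding eqs(2) by (rule transform_transform[OF X one_carrier_mat one_carrier_mat Tc Sc])
        also have "\<dots> = transform (1\<^sub>m n * 1\<^sub>m n * g) (\<lambda>i. h i * (S i * T i)) Ms"
        proof (rule transform_transform[OF Ms _ gc _ hc])
          show "S i * T i \<in> carrier_mat (ds ! i) (ds ! i)" if "i < length ds" for i
            using Sc[OF that] Tc[OF that] by (rule mult_carrier_mat)
        qed simp_all
        finally have eq: "transform (1\<^sub>m n) T X'
            = transform (1\<^sub>m n * 1\<^sub>m n * g) (\<lambda>i. h i * (S i * T i)) Ms" .
        have "F (transform (1\<^sub>m n) T X') = 0"
          unfolding eq
        proof (rule van)
          show "1\<^sub>m n * 1\<^sub>m n * g \<in> GL_mat n" using g by (intro mult_in_GL_mat) simp_all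
          show "(\<lambda>i. h i * (S i * T i)) \<in> base_changes ds"
            using h S T unfolding base_changes_def by (blast intro: mult_in_GL_mat)
        qed
        then have "f (pluecker (transform g h Ms)) = 0"
          using f_eq[OF X', of T'] GL_matD(1)[OF base_changesD[OF T']] by (simp add: eqs(1))
        then show ?thesis by (simp add: f'_top)
      qed
      moreover have "basis_matrices ds n (map (vec_space.col_space n) Ns) Ns"
        unfolding basis_matrices_def
      proof (intro conjI allI impI)
        fix i assume i: "i < length ds"
        have "injective_mat (ds ! i) (Ns ! i)"
          using identity_top_injective[OF mat_tuplesD(2)[OF Ns(1) i] le[OF i]] Ns(2) i
          by (simp add: normalized_tuple_def)
        then show "basis_matrix (ds ! i) n (map (vec_space.col_space n) Ns ! i) (Ns ! i)"
          using vec_space.basis_matrix_iff_injective[OF mat_tuplesD(2)[OF Ns(1) i]] i mat_tuplesD(1)[OF Ns(1)]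
          by simp
      qed (use mat_tuplesD(1)[OF Ns(1)] in auto)
      ultimately have "f' (pluecker Ns) = 0"
        using dense_orbit_zero_locus[OF Ws(2) bas f'] by blast
      then have "f (pluecker Ns) = 0"
        using top1[OF Ns(2,1)] by (simp add: f'_top)
      then show ?thesis
        using f_eq[OF Ns, of "\<lambda>i. 1\<^sub>m (ds ! i)"] transform_one[OF Ns(1), of "\<lambda>i. 1\<^sub>m (ds ! i)"]
        by simp
    qed
    show "F Ns = 0"
    proof (rule regular_mult_eq_0[OF inf F])
      show "regular ds n (\<lambda>Ns. \<Prod>i<length ds. top Ns i)"
        using multihomogeneous_regular[OF multihom_top] by (simp add: top_pluecker)
      show "F Ns = 0" if Ns: "Ns \<in> mat_tuples ds n" and nz: "(\<Prod>i<length ds. top Ns i) \<noteq> 0" for Ns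
      proof -
        have "det (submatrix (Ns ! i) {..<ds ! i} UNIV) \<noteq> 0" if "i < length ds" for i
          using nz that by (auto simp: top_def)
        from normalize_tuple[OF Ns le this] show ?thesis using normalized by metis
      qed
      \<comment> \<open>The origin of the chart shows that the product of the top minors is not identically zero.\<close>
      define E where "E = map (\<lambda>i. mat n (ds ! i) (\<lambda>(k, l). if k = l then 1 else 0 :: 'a)) [0..<length ds]"
      show E: "E \<in> mat_tuples ds n" by (auto simp: E_def mat_tuples_def)
      have "k < n" if "i < length ds" "k < ds ! i" for i k using le[OF that(1)] that(2) by simp
      then have "normalized_tuple ds E"
        by (auto simp: normalized_tuple_def identity_top_def E_def)
      then show "(\<Prod>i<length ds. top E i) \<noteq> 0"
        using top1[OF _ E] by simp
    qed (rule Ns)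
  qed
  then have "generic_tuple ds n Ms" unfolding generic_tuple_def by blast
  with Ms inj show ?thesis by blast
qed

section \<open>Block matrices\<close>

text \<open>A column of \<open>[M\<^sub>1 | \<dots> | M\<^sub>r]\<close> is addressed by its block and its position in the block.  Taking an
  arbitrary bijection avoids arithmetic with the offsets of the blocks.\<close>

definition block_index :: "nat list \<Rightarrow> nat \<Rightarrow> nat \<times> nat" where
  "block_index ds = (SOME \<beta>. bij_betw \<beta> {..<sum_list ds} (SIGMA i:{..<length ds}. {..<ds ! i}))"

lemma bij_block_index:
  "bij_betw (block_index ds) {..<sum_list ds} (SIGMA i:{..<length ds}. {..<ds ! i})"
proof -
  have "card {..<sum_list ds} = card (SIGMA i:{..<length ds}. {..<ds ! i})"
    by (simp add: sum_list_sum_nth atLeast0LessThan)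
  then have "\<exists>\<beta>. bij_betw \<beta> {..<sum_list ds} (SIGMA i:{..<length ds}. {..<ds ! i})"
    by (intro finite_same_card_bij) auto
  then show ?thesis unfolding block_index_def by (rule someI_ex)
qed

lemma block_index_in_range:
  assumes "c < sum_list ds"
  shows "fst (block_index ds c) < length ds"
    "snd (block_index ds c) < ds ! fst (block_index ds c)"
proof -
  have "block_index ds c \<in> (SIGMA i:{..<length ds}. {..<ds ! i})"
    using bij_betwE[OF bij_block_index, of ds] assms by blast
  then show "fst (block_index ds c) < length ds" "snd (block_index ds c) < ds ! fst (block_index ds c)"
    by auto
qed

lemma block_index_inj:
  assumes "c < sum_list ds" "c' < sum_list ds" "block_index ds c = block_index ds c'"
  shows "c = c'"
  using bij_block_index[of ds] assms by (auto simp: bij_betw_def inj_on_def)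

definition hcat :: "nat list \<Rightarrow> nat \<Rightarrow> 'a::field mat list \<Rightarrow> 'a mat" where
  "hcat ds n Ms = mat n (sum_list ds)
     (\<lambda>(k, c). Ms ! fst (block_index ds c) $$ (k, snd (block_index ds c)))"

text \<open>The columns of the identity matrix that belong to block \<open>i\<close>.\<close>

definition block_unit :: "nat list \<Rightarrow> nat \<Rightarrow> 'a::field mat" where
  "block_unit ds i = mat (sum_list ds) (ds ! i) (\<lambda>(k, l). if block_index ds k = (i, l) then 1 else 0)"

lemma hcat_carrier [simp]: "hcat ds n Ms \<in> carrier_mat n (sum_list ds)"
  by (simp add: hcat_def)

lemma block_unit_carrier [simp]: "block_unit ds i \<in> carrier_mat (sum_list ds) (ds ! i)"
  by (simp add: block_unit_def)

lemma hcat_mult_block_unit: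
  assumes i: "i < length ds" and M: "Ms ! i \<in> carrier_mat n (ds ! i)"
  shows "hcat ds n Ms * block_unit ds i = Ms ! i"
proof (rule eq_matI)
  fix k l assume "k < dim_row (Ms ! i)" "l < dim_col (Ms ! i)"
  then have kl: "k < n" "l < ds ! i" using M by auto
  have "(i, l) \<in> (SIGMA i:{..<length ds}. {..<ds ! i})" using i kl by simp
  then have "(i, l) \<in> block_index ds ` {..<sum_list ds}"
    by (simp only: bij_betw_imp_surj_on[OF bij_block_index])
  then obtain c where c: "c < sum_list ds" "block_index ds c = (i, l)" by auto
  have unique: "block_index ds c' = (i, l) \<longleftrightarrow> c' = c" if "c' < sum_list ds" for c'
    using block_index_inj[OF that c(1)] c(2) by auto
  have "(hcat ds n Ms * block_unit ds i) $$ (k, l) =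
      (\<Sum>c'\<in>{0..<sum_list ds}. Ms ! fst (block_index ds c') $$ (k, snd (block_index ds c')) *
        (if block_index ds c' = (i, l) then 1 else 0))"
    using kl by (simp add: hcat_def block_unit_def scalar_prod_def)
  also have "\<dots> = (\<Sum>c'\<in>{0..<sum_list ds}. if c' = c then Ms ! i $$ (k, l) else 0)"
    by (intro sum.cong) (auto simp: unique c(2))
  finally show "(hcat ds n Ms * block_unit ds i) $$ (k, l) = Ms ! i $$ (k, l)" using c by simp
qed (use M in \<open>auto simp: hcat_def block_unit_def\<close>)

lemma hcat_block_units:
  assumes "\<And>i. i < length ds \<Longrightarrow> Ms ! i = block_unit ds i"
  shows "hcat ds (sum_list ds) Ms = 1\<^sub>m (sum_list ds)"
proof (rule eq_matI)
  fix k c assume "k < dim_row (1\<^sub>m (sum_list ds) :: 'a mat)" "c < dim_col (1\<^sub>m (sum_list ds) :: 'a mat)"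
  then have kc: "k < sum_list ds" "c < sum_list ds" by auto
  have "hcat ds (sum_list ds) Ms $$ (k, c)
      = block_unit ds (fst (block_index ds c)) $$ (k, snd (block_index ds c))"
    using kc assms[OF block_index_in_range(1)[OF kc(2)]] by (simp add: hcat_def)
  also have "\<dots> = (if k = c then 1 else 0)"
    using kc block_index_in_range[OF kc(2)] block_index_inj[OF kc] by (auto simp: block_unit_def)
  finally show "hcat ds (sum_list ds) Ms $$ (k, c) = 1\<^sub>m (sum_list ds) $$ (k, c)" using kc by simp
qed (auto simp: hcat_def)

lemma regular_mat_hcat:
  assumes "length ds \<le> length ds'" "\<And>i. i < length ds \<Longrightarrow> ds' ! i = ds ! i"
  shows "regular_mat ds' n n (sum_list ds) (hcat ds n)"
proof (rule regular_matI)
  show "regular ds' n (\<lambda>Ms. hcat ds n Ms $$ (k, c))" if kc: "k < n" "c < sum_list ds" for k c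
  proof (rule regular.cong)
    show "regular ds' n (\<lambda>Ms. Ms ! fst (block_index ds c) $$ (k, snd (block_index ds c)))"
      using kc assms block_index_in_range[OF kc(2)] by (intro regular.entry) auto
    show "Ms ! fst (block_index ds c) $$ (k, snd (block_index ds c)) = hcat ds n Ms $$ (k, c)" for Ms
      using kc by (simp add: hcat_def)
  qed
qed simp

definition append_cols :: "'a::field mat \<Rightarrow> 'a mat \<Rightarrow> 'a mat" where
  "append_cols A B = four_block_mat A B (0\<^sub>m 0 (dim_col A)) (0\<^sub>m 0 (dim_col B))"

lemma append_cols_carrier [simp]:
  "A \<in> carrier_mat n p \<Longrightarrow> B \<in> carrier_mat n q \<Longrightarrow> append_cols A B \<in> carrier_mat n (p + q)"
  by (auto simp: append_cols_def)

lemma append_cols_index: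
  assumes "A \<in> carrier_mat n p" "B \<in> carrier_mat n q" "i < n" "j < p + q"
  shows "append_cols A B $$ (i, j) = (if j < p then A $$ (i, j) else B $$ (i, j - p))"
  using assms by (auto simp: append_cols_def)

lemma regular_mat_append_cols:
  assumes X: "regular_mat ds n p q X" and Y: "regular_mat ds n p r Y"
  shows "regular_mat ds n p (q + r) (\<lambda>Ms. append_cols (X Ms) (Y Ms))"
proof (rule regular_matI)
  show "append_cols (X Ms) (Y Ms) \<in> carrier_mat p (q + r)" if "Ms \<in> mat_tuples ds n" for Ms
    using regular_matD(1)[OF X that] regular_matD(1)[OF Y that] by simp
  show "regular ds n (\<lambda>Ms. append_cols (X Ms) (Y Ms) $$ (i, j))" if ij: "i < p" "j < q + r" for i j
  proof (rule regular.cong)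
    have "regular ds n (\<lambda>Ms. X Ms $$ (i, j))" if "j < q" using regular_matD(2)[OF X ij(1) that] .
    moreover have "regular ds n (\<lambda>Ms. Y Ms $$ (i, j - q))" if "\<not> j < q"
      using that ij by (intro regular_matD(2)[OF Y]) auto
    ultimately show "regular ds n (\<lambda>Ms. if j < q then X Ms $$ (i, j) else Y Ms $$ (i, j - q))"
      by (cases "j < q") auto
    show "(if j < q then X Ms $$ (i, j) else Y Ms $$ (i, j - q)) = append_cols (X Ms) (Y Ms) $$ (i, j)"
      if "Ms \<in> mat_tuples ds n" for Ms
      using append_cols_index[OF regular_matD(1)[OF X that] regular_matD(1)[OF Y that] ij] by simp
  qed
qed

lemma append_rows_index:
  assumes "A \<in> carrier_mat p n" "B \<in> carrier_mat q n" "i < p + q" "j < n"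
  shows "(A @\<^sub>r B) $$ (i, j) = (if i < p then A $$ (i, j) else B $$ (i - p, j))"
  using assms by (auto simp: append_rows_def)

lemma append_cols_mult_append_rows:
  assumes A: "A \<in> carrier_mat n p" and B: "B \<in> carrier_mat n q"
    and C: "C \<in> carrier_mat p r" and D: "D \<in> carrier_mat q r"
  shows "append_cols A B * (C @\<^sub>r D) = A * C + B * D"
proof -
  have "append_cols A B * (C @\<^sub>r D) = four_block_mat (A * C + B * D)
      (A * 0\<^sub>m p 0 + B * 0\<^sub>m q 0) (0\<^sub>m 0 p * C + 0\<^sub>m 0 q * D) (0\<^sub>m 0 p * 0\<^sub>m p 0 + 0\<^sub>m 0 q * 0\<^sub>m q 0)"
    using mult_four_block_mat[OF A B zero_carrier_mat zero_carrier_mat C zero_carrier_mat D zero_carrier_mat,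
        of 0 0] A B C D
    by (simp add: append_cols_def append_rows_def)
  also have "\<dots> = A * C + B * D"
    using A B C D by (intro eq_matI) auto
  finally show ?thesis .
qed

lemma append_cols_mult_diag:
  assumes A: "A \<in> carrier_mat n p" and B: "B \<in> carrier_mat n q"
    and X: "X \<in> carrier_mat p p" and Y: "Y \<in> carrier_mat q q"
  shows "append_cols A B * four_block_mat X (0\<^sub>m p q) (0\<^sub>m q p) Y = append_cols (A * X) (B * Y)"
proof -
  have "append_cols A B * four_block_mat X (0\<^sub>m p q) (0\<^sub>m q p) Y = four_block_mat
      (A * X + B * 0\<^sub>m q p) (A * 0\<^sub>m p q + B * Y) (0\<^sub>m 0 p * X + 0\<^sub>m 0 q * 0\<^sub>m q p)
      (0\<^sub>m 0 p * 0\<^sub>m p q + 0\<^sub>m 0 q * Y)"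
    using mult_four_block_mat[OF A B zero_carrier_mat zero_carrier_mat X zero_carrier_mat zero_carrier_mat Y,
        of 0] A B
    by (simp add: append_cols_def)
  also have "\<dots> = append_cols (A * X) (B * Y)"
    using A B X Y by (intro eq_matI) (auto simp: append_cols_def)
  finally show ?thesis .
qed

lemma append_cols_unit:
  "append_cols (1\<^sub>m p @\<^sub>r 0\<^sub>m q p) (0\<^sub>m p q @\<^sub>r 1\<^sub>m q) = (1\<^sub>m (p + q) :: 'a::field mat)"
  by (intro eq_matI) (auto simp: append_cols_def append_rows_def)

lemma injective_mat_append_rows:
  assumes A: "A \<in> carrier_mat p d" and B: "B \<in> carrier_mat q d"
    and "injective_mat d A \<or> injective_mat d B"
  shows "injective_mat d (A @\<^sub>r B)"
  unfolding injective_mat_def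
proof (intro ballI impI)
  fix v :: "'a vec" assume v: "v \<in> carrier_vec d" and "(A @\<^sub>r B) *\<^sub>v v = 0\<^sub>v (dim_row (A @\<^sub>r B))"
  then have "(A *\<^sub>v v) @\<^sub>v (B *\<^sub>v v) = 0\<^sub>v (p + q)"
    using mat_mult_append[OF A B v] A B by (simp add: append_rows_def)
  also have "0\<^sub>v (p + q) = 0\<^sub>v p @\<^sub>v (0\<^sub>v q :: 'a vec)" by (intro eq_vecI) auto
  finally have "A *\<^sub>v v = 0\<^sub>v p \<and> B *\<^sub>v v = 0\<^sub>v q"
    by (subst (asm) append_vec_eq[of _ p]) (use A v in auto)
  then show "v = 0\<^sub>v d" using assms v by (auto simp: injective_mat_def)
qed

lemma injective_one: "injective_mat d (1\<^sub>m d)"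
  by (auto simp: injective_mat_def)

lemma adj_mat_one: "adj_mat (1\<^sub>m n :: 'a::field mat) = 1\<^sub>m n"
proof -
  have "adj_mat (1\<^sub>m n :: 'a mat) = 1 \<cdot>\<^sub>m 1\<^sub>m n"
    using adj_mat[of "1\<^sub>m n :: 'a mat" n] by simp
  then show ?thesis by (auto intro: eq_matI)
qed

lemma hcat_block_units_append_zero:
  assumes Ms: "\<And>i. i < length ds \<Longrightarrow> Ms ! i = block_unit ds i @\<^sub>r 0\<^sub>m q (ds ! i)"
  shows "hcat ds (sum_list ds + q) Ms = 1\<^sub>m (sum_list ds) @\<^sub>r 0\<^sub>m q (sum_list ds)"
proof (rule eq_matI)
  let ?m = "sum_list ds"
  fix k c assume "k < dim_row (1\<^sub>m ?m @\<^sub>r 0\<^sub>m q ?m :: 'a mat)" "c < dim_col (1\<^sub>m ?m @\<^sub>r 0\<^sub>m q ?m :: 'a mat)"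
  then have kc: "k < ?m + q" "c < ?m" by (auto simp: append_rows_def)
  define Us :: "'a mat list" where "Us = map (block_unit ds) [0..<length ds]"
  have Us: "Us ! i = block_unit ds i" if "i < length ds" for i using that by (simp add: Us_def)
  note range = block_index_in_range[OF kc(2)]
  have "hcat ds (?m + q) Ms $$ (k, c) = (if k < ?m then hcat ds ?m Us $$ (k, c) else 0)"
    using kc range Ms[OF range(1)] Us[OF range(1)]
    by (simp add: hcat_def append_rows_index[OF block_unit_carrier zero_carrier_mat])
  also have "\<dots> = (1\<^sub>m ?m @\<^sub>r 0\<^sub>m q ?m) $$ (k, c)"
    using kc hcat_block_units[OF Us] by (simp add: append_rows_index[OF one_carrier_mat zero_carrier_mat])
  finally show "hcat ds (?m + q) Ms $$ (k, c) = (1\<^sub>m ?m @\<^sub>r 0\<^sub>m q ?m) $$ (k, c)" .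
qed (auto simp: hcat_def append_rows_def)

lemma assoc_mult_mat_5:
  assumes "G \<in> carrier_mat n m" "A \<in> carrier_mat m m" "u \<in> carrier_mat m m"
    and "p \<in> carrier_mat m d" "h \<in> carrier_mat d e"
  shows "G * (A * u) * p * h = G * (A * (u * p * h))"
proof -
  have "G * (A * u) * p * h = G * (A * u) * (p * h)"
    by (rule assoc_mult_mat[of _ n m _ d _ e]) (use assms in auto)
  also have "\<dots> = G * (A * u * (p * h))"
    by (rule assoc_mult_mat[of _ n m _ m _ e]) (use assms in auto)
  also have "A * u * (p * h) = A * (u * (p * h))"
    by (rule assoc_mult_mat[of _ m m _ m _ e]) (use assms in auto)
  also have "u * (p * h) = u * p * h"
    by (rule assoc_mult_mat[of _ m m _ d _ e, symmetric]) (use assms in auto)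
  finally show ?thesis .
qed

section \<open>Lifting a generic tuple\<close>

text \<open>From a configuration \<open>(P\<^sub>1, \<dots>, P\<^sub>r, Q)\<close> in \<open>V/B\<close> to one in \<open>V/B \<oplus> B\<close>: the \<open>P\<^sub>i\<close> are placed in the first
  summand, \<open>B\<close> is the second one, and the last member is the graph of the map \<open>Q\<close> from \<open>B\<close> to \<open>V/B\<close>.\<close>

definition lift_tuple :: "nat list \<Rightarrow> nat \<Rightarrow> 'a::field mat list \<Rightarrow> 'a mat list" where
  "lift_tuple as b Ps = map (\<lambda>i.
     if i < length as then Ps ! i @\<^sub>r 0\<^sub>m b (as ! i)
     else if i = length as then 0\<^sub>m (sum_list as) b @\<^sub>r 1\<^sub>m b
     else Ps ! length as @\<^sub>r 1\<^sub>m b) [0..<length as + 2]"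

text \<open>The tuple in the frame \<open>[G | B]\<close> of \<open>V\<close> that corresponds to \<open>Vs = (P\<^sub>1, \<dots>, P\<^sub>r, Q)\<close> after the change of
  coordinates that takes \<open>P = [P\<^sub>1 | \<dots> | P\<^sub>r]\<close> to the identity.  The adjugate replaces \<open>P\<inverse>\<close> in order to
  have polynomial entries; the factor \<open>det P\<close> by which they differ is absorbed by base changes.\<close>

definition spread_tuple ::
    "nat list \<Rightarrow> 'a::field mat \<Rightarrow> 'a mat \<Rightarrow> 'a mat \<Rightarrow> 'a mat list \<Rightarrow> 'a mat list" where
  "spread_tuple as G B S Vs = map (\<lambda>i.
     if i < length as then G * block_unit as i
     else if i = length as then B
     else G * (adj_mat (hcat as (sum_list as) Vs) * Vs ! length as) + B * S) [0..<length as + 2]"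

context
  fixes as :: "nat list" and b m n :: nat and ds ds' :: "nat list"
  defines "m \<equiv> sum_list as" and "n \<equiv> sum_list as + b"
    and "ds \<equiv> as @ [b]" and "ds' \<equiv> as @ [b, b]"
begin

lemma dims:
  "length ds = Suc (length as)" "length ds' = Suc (Suc (length as))"
  "i < length as \<Longrightarrow> ds ! i = as ! i" "ds ! length as = b"
  "i < length as \<Longrightarrow> ds' ! i = as ! i" "ds' ! length as = b" "ds' ! Suc (length as) = b"
  by (simp_all add: ds_def ds'_def nth_append)

lemma factor_cases:
  assumes "i < length ds'"
  obtains "i < length as" | "i = length as" | "i = Suc (length as)"
  using assms by (auto simp: dims less_Suc_eq)

lemma lift_tuple_nth:
  "i < length as \<Longrightarrow> lift_tuple as b Ps ! i = Ps ! i @\<^sub>r 0\<^sub>m b (as ! i)"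
  "lift_tuple as b Ps ! length as = 0\<^sub>m m b @\<^sub>r 1\<^sub>m b"
  "lift_tuple as b Ps ! Suc (length as) = Ps ! length as @\<^sub>r 1\<^sub>m b"
  by (simp_all add: lift_tuple_def m_def del: upt_Suc)

lemma spread_tuple_nth:
  "i < length as \<Longrightarrow> spread_tuple as G B S Vs ! i = G * block_unit as i"
  "spread_tuple as G B S Vs ! length as = B"
  "spread_tuple as G B S Vs ! Suc (length as) = G * (adj_mat (hcat as m Vs) * Vs ! length as) + B * S"
  by (simp_all add: spread_tuple_def m_def del: upt_Suc)

lemma length_lift_tuple: "length (lift_tuple as b Ps) = length ds'"
  and length_spread_tuple: "length (spread_tuple as G B S Vs) = length ds'"
  by (simp_all add: lift_tuple_def spread_tuple_def dims)

lemma lift_tuple_in_mat_tuples: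
  assumes "Ps \<in> mat_tuples ds m"
  shows "lift_tuple as b Ps \<in> mat_tuples ds' n"
proof -
  have "lift_tuple as b Ps ! i \<in> carrier_mat n (ds' ! i)" if "i < length ds'" for i
    using that
  proof (cases rule: factor_cases)
    case 1
    then show ?thesis using mat_tuplesD(2)[OF assms, of i] by (simp add: lift_tuple_nth dims m_def n_def)
  next
    case 2
    then show ?thesis by (simp add: lift_tuple_nth dims m_def n_def)
  next
    case 3
    then show ?thesis using mat_tuplesD(2)[OF assms, of "length as"]
      by (simp add: lift_tuple_nth dims m_def n_def)
  qed
  then show ?thesis by (simp add: mat_tuples_def length_lift_tuple)
qed

lemma injective_lift_tuple:
  assumes Ps: "Ps \<in> mat_tuples ds m"
    and inj: "\<And>i. i < length ds \<Longrightarrow> injective_mat (ds ! i) (Ps ! i)"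
    and i: "i < length ds'"
  shows "injective_mat (ds' ! i) (lift_tuple as b Ps ! i)"
  using i
proof (cases rule: factor_cases)
  case 1
  then show ?thesis
    using injective_mat_append_rows[of "Ps ! i" m "as ! i" "0\<^sub>m b (as ! i)" b]
      mat_tuplesD(2)[OF Ps, of i] inj[of i] by (simp add: lift_tuple_nth dims)
next
  case 2
  then show ?thesis
    using injective_mat_append_rows[of "0\<^sub>m m b" m b "1\<^sub>m b" b] by (simp add: lift_tuple_nth dims injective_one)
next
  case 3
  then show ?thesis
    using injective_mat_append_rows[of "Ps ! length as" m b "1\<^sub>m b" b]
      mat_tuplesD(2)[OF Ps, of "length as"] by (simp add: lift_tuple_nth dims injective_one)
qed

lemma spread_tuple_in_mat_tuples:
  assumes G: "G \<in> carrier_mat n m" and B: "B \<in> carrier_mat n b" and S: "S \<in> carrier_mat b b"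
    and Vs: "Vs \<in> mat_tuples ds m"
  shows "spread_tuple as G B S Vs \<in> mat_tuples ds' n"
proof -
  have "adj_mat (hcat as m Vs) \<in> carrier_mat m m"
    using adj_mat(1)[of "hcat as m Vs" m] hcat_carrier[of as m Vs] by (simp add: m_def)
  then have last: "G * (adj_mat (hcat as m Vs) * Vs ! length as) + B * S \<in> carrier_mat n b"
    using G B S mat_tuplesD(2)[OF Vs, of "length as"] by (simp add: dims)
  have block: "G * block_unit as i \<in> carrier_mat n (as ! i)" for i
    using G block_unit_carrier[of as i] unfolding m_def by (rule mult_carrier_mat)
  have "spread_tuple as G B S Vs ! i \<in> carrier_mat n (ds' ! i)" if "i < length ds'" for i
    using that by (cases rule: factor_cases) (use last block B in \<open>simp_all add: spread_tuple_nth dims\<close>)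
  then show ?thesis by (simp add: mat_tuples_def length_spread_tuple)
qed

lemma regular_spread_tuple:
  assumes G: "G \<in> carrier_mat n m" and B: "B \<in> carrier_mat n b" and S: "S \<in> carrier_mat b b"
    and F: "regular ds' n F"
  shows "regular ds m (\<lambda>Vs. F (spread_tuple as G B S Vs))"
  using F
proof (rule regular_compose)
  show "spread_tuple as G B S Vs \<in> mat_tuples ds' n" if "Vs \<in> mat_tuples ds m" for Vs
    using spread_tuple_in_mat_tuples[OF G B S that] .
  have "regular_mat ds m m b (\<lambda>Vs. Vs ! length as)"
    using regular_mat_component[of "length as" ds m] by (simp add: dims)
  moreover have "regular_mat ds m m m (hcat as m)"
    using regular_mat_hcat[of as ds m] by (simp add: dims m_def)
  ultimately have last: "regular_mat ds m n b
      (\<lambda>Vs. G * (adj_mat (hcat as m Vs) * Vs ! length as) + B * S)"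
    using G B S
    by (intro regular_mat_add regular_mat_const regular_mat_mult[where q = m] regular_mat_adj) auto
  show "regular ds m (\<lambda>Vs. spread_tuple as G B S Vs ! i $$ (k, l))"
    if i: "i < length ds'" and kl: "k < n" "l < ds' ! i" for i k l
    using i
  proof (cases rule: factor_cases)
    case 1
    then show ?thesis by (simp add: spread_tuple_nth regular.const)
  next
    case 2
    then show ?thesis by (simp add: spread_tuple_nth regular.const)
  next
    case 3
    then show ?thesis using regular_matD(2)[OF last kl(1), of l] kl(2) by (simp add: spread_tuple_nth dims)
  qed
qed

text \<open>With \<open>P = [u P\<^sub>1 h\<^sub>1 | \<dots> | u P\<^sub>r h\<^sub>r]\<close>, the matrix \<open>X = adj P u\<close> takes \<open>P\<^sub>i h\<^sub>i\<close> to \<open>det P\<close> times the \<open>i\<close>-th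
  block unit.  Hence \<open>[G X | B Y]\<close> moves the first \<open>r\<close> members of the lifted tuple as required, for every
  invertible \<open>Y\<close>.  The last member becomes \<open>G X Q + B Y\<close>, and \<open>Y = S h\<inverse>\<close>, with \<open>h\<close> the base change of
  \<open>Q\<close>, gives it the right lower part.\<close>

lemma spread_orbit:
  fixes Ps :: "'a::field mat list"
  assumes Ps: "Ps \<in> mat_tuples ds m"
    and G: "G \<in> carrier_mat n m" and B: "B \<in> carrier_mat n b" and GB: "append_cols G B \<in> GL_mat n"
    and S: "S \<in> GL_mat b" and u: "u \<in> GL_mat m" and h: "h \<in> base_changes ds"
    and P: "det (hcat as m (transform u h Ps)) \<noteq> 0"
  shows "\<exists>k \<in> GL_mat n. \<exists>h' \<in> base_changes ds'.
    spread_tuple as G B S (transform u h Ps) = transform k h' (lift_tuple as b Ps)"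
proof -
  define r where "r = length as"
  define Vs where "Vs = transform u h Ps"
  define P where "P = hcat as m Vs"
  define \<delta> where "\<delta> = det P"
  have \<delta>: "\<delta> \<noteq> 0" using P by (simp add: \<delta>_def P_def Vs_def)
  note uc = GL_matD(1)[OF u] and Sc = GL_matD(1)[OF S]
  have hc: "h i \<in> carrier_mat (ds ! i) (ds ! i)" if "i < length ds" for i
    using GL_matD(1)[OF base_changesD[OF h that]] .
  have Vs: "Vs \<in> mat_tuples ds m"
    unfolding Vs_def by (rule transform_in_mat_tuples[OF Ps uc hc])
  have V_nth: "Vs ! i = u * Ps ! i * h i" if "i < length ds" for i
    using that mat_tuplesD(1)[OF Ps] by (simp add: Vs_def)
  have Pc: "P \<in> carrier_mat m m" unfolding P_def m_def by simp
  have Ac: "adj_mat P \<in> carrier_mat m m" and AP: "adj_mat P * P = \<delta> \<cdot>\<^sub>m 1\<^sub>m m"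
    using adj_mat[OF Pc] by (simp_all add: \<delta>_def)
  define X where "X = adj_mat P * u"
  have "det (adj_mat P) * \<delta> = \<delta> ^ m"
    using arg_cong[OF AP, of det] det_mult[OF Ac Pc] by (simp add: \<delta>_def)
  then have "det (adj_mat P) \<noteq> 0" using \<delta> by auto
  then have X: "X \<in> GL_mat m"
    unfolding X_def by (rule mult_in_GL_mat[OF GL_matI[OF Ac] u])
  have hr: "h r \<in> GL_mat b" using base_changesD[OF h, of r] by (simp add: r_def dims)
  obtain hi where hi: "hi \<in> GL_mat b" "hi * h r = 1\<^sub>m b" using GL_mat_inverse[OF hr] by blast
  define Y where "Y = S * hi"
  have Y: "Y \<in> GL_mat b" unfolding Y_def using S hi(1) by (rule mult_in_GL_mat)
  obtain Y' where Y': "Y' \<in> GL_mat b" "Y * Y' = 1\<^sub>m b" using GL_mat_inverse[OF Y] by blast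
  note Xc = GL_matD(1)[OF X] and Yc = GL_matD(1)[OF Y] and Y'c = GL_matD(1)[OF Y'(1)]
    and hic = GL_matD(1)[OF hi(1)] and hrc = GL_matD(1)[OF hr]
  have Yh: "Y * h r = S"
    unfolding Y_def using assoc_mult_mat[OF Sc hic hrc] hi(2) Sc by simp
  define k where "k = append_cols (G * X) (B * Y)"
  have GX: "G * X \<in> carrier_mat n m" and BY: "B * Y \<in> carrier_mat n b"
    using G Xc B Yc by simp_all
  have kg: "k = append_cols G B * four_block_mat X (0\<^sub>m m b) (0\<^sub>m b m) Y"
    unfolding k_def using append_cols_mult_diag[OF G B Xc Yc] by simp
  have "det (four_block_mat X (0\<^sub>m m b) (0\<^sub>m b m) Y) = det X * det Y"
    by (rule det_four_block_mat_lower_left_zero[OF Xc zero_carrier_mat refl Yc])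
  then have "four_block_mat X (0\<^sub>m m b) (0\<^sub>m b m) Y \<in> GL_mat n"
    using X Y Xc Yc by (intro GL_matI) (auto simp: n_def m_def GL_mat_def)
  then have k: "k \<in> GL_mat n" unfolding kg using GB by (intro mult_in_GL_mat)
  define h' where "h' i = (if i < r then (1 / \<delta>) \<cdot>\<^sub>m h i else if i = r then Y' else h r)" for i
  have h': "h' \<in> base_changes ds'"
    unfolding base_changes_def
  proof (intro CollectI allI impI)
    fix i assume "i < length ds'"
    then show "h' i \<in> GL_mat (ds' ! i)"
    proof (cases rule: factor_cases)
      case 1
      then show ?thesis
        using base_changesD[OF h, of i] \<delta> by (simp add: h'_def r_def dims smult_in_GL_mat)
    next
      case 2
      then show ?thesis using Y'(1) by (simp add: h'_def r_def dims)
    next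
      case 3
      then show ?thesis using hr by (simp add: h'_def r_def dims)
    qed
  qed
  have "spread_tuple as G B S Vs = transform k h' (lift_tuple as b Ps)"
  proof (rule nth_equalityI)
    show "length (spread_tuple as G B S Vs) = length (transform k h' (lift_tuple as b Ps))"
      by (simp add: length_spread_tuple length_lift_tuple)
    fix i assume "i < length (spread_tuple as G B S Vs)"
    then have i: "i < length ds'" by (simp add: length_spread_tuple)
    have T: "transform k h' (lift_tuple as b Ps) ! i = k * lift_tuple as b Ps ! i * h' i"
      using i by (simp add: length_lift_tuple)
    from i show "spread_tuple as G B S Vs ! i = transform k h' (lift_tuple as b Ps) ! i"
    proof (cases rule: factor_cases)
      case 1
      then have Psi: "Ps ! i \<in> carrier_mat m (as ! i)" and hi: "h i \<in> carrier_mat (as ! i) (as ! i)"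
        and Vi: "Vs ! i \<in> carrier_mat m (as ! i)"
        using mat_tuplesD(2)[OF Ps, of i] mat_tuplesD(2)[OF Vs, of i] hc[of i] by (simp_all add: dims)
      have E: "(block_unit as i :: 'a mat) \<in> carrier_mat m (as ! i)" unfolding m_def by simp
      have PE: "P * block_unit as i = Vs ! i"
        unfolding P_def by (rule hcat_mult_block_unit[OF 1 Vi])
      have "G * X * Ps ! i * h i = G * (adj_mat P * (P * block_unit as i))"
        unfolding X_def assoc_mult_mat_5[OF G Ac uc Psi hi] PE using V_nth[of i] 1 by (simp add: dims)
      also have "adj_mat P * (P * block_unit as i) = \<delta> \<cdot>\<^sub>m block_unit as i"
        using assoc_mult_mat[OF Ac Pc E] AP mult_smult_assoc_mat[OF one_carrier_mat E, of \<delta>]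
          left_mult_one_mat[OF E] by simp
      also have "G * (\<delta> \<cdot>\<^sub>m block_unit as i) = \<delta> \<cdot>\<^sub>m (G * block_unit as i)"
        by (rule mult_smult_distrib[OF G E])
      finally have GXPh: "G * X * Ps ! i * h i = \<delta> \<cdot>\<^sub>m (G * block_unit as i)" .
      have "k * lift_tuple as b Ps ! i = G * X * Ps ! i"
        unfolding k_def lift_tuple_nth(1)[OF 1]
        unfolding append_cols_mult_append_rows[OF GX BY Psi zero_carrier_mat] right_mult_zero_mat[OF BY]
        by (rule right_add_zero_mat[OF mult_carrier_mat[OF GX Psi]])
      then have "k * lift_tuple as b Ps ! i * h' i = G * X * Ps ! i * ((1 / \<delta>) \<cdot>\<^sub>m h i)"
        using 1 by (simp add: h'_def r_def)
      also have "\<dots> = (1 / \<delta>) \<cdot>\<^sub>m (G * X * Ps ! i * h i)"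
        using mult_smult_distrib[of "G * X * Ps ! i" n "as ! i" "h i" "as ! i"] GX Psi hi by simp
      also have "\<dots> = G * block_unit as i"
        unfolding GXPh using \<delta> by (intro eq_matI) auto
      finally show ?thesis using 1 T by (simp add: spread_tuple_nth)
    next
      case 2
      have "k * lift_tuple as b Ps ! i = B * Y"
        unfolding k_def 2 lift_tuple_nth(2)
        unfolding append_cols_mult_append_rows[OF GX BY zero_carrier_mat one_carrier_mat]
          right_mult_zero_mat[OF GX] right_mult_one_mat[OF BY] by (rule left_add_zero_mat[OF BY])
      then have "k * lift_tuple as b Ps ! i * h' i = B * Y * Y'" using 2 by (simp add: h'_def r_def)
      also have "\<dots> = B" using assoc_mult_mat[OF B Yc Y'c] Y'(2) B by simp
      finally show ?thesis using 2 T by (simp add: spread_tuple_nth)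
    next
      case 3
      have Pr: "Ps ! r \<in> carrier_mat m b" using mat_tuplesD(2)[OF Ps, of r] by (simp add: dims r_def)
      have "k * lift_tuple as b Ps ! i = G * X * Ps ! r + B * Y"
        unfolding k_def 3 lift_tuple_nth(3)
        unfolding r_def[symmetric] append_cols_mult_append_rows[OF GX BY Pr one_carrier_mat] right_mult_one_mat[OF BY] ..
      then have "k * lift_tuple as b Ps ! i * h' i = (G * X * Ps ! r + B * Y) * h r"
        using 3 by (simp add: h'_def r_def)
      also have "\<dots> = G * X * Ps ! r * h r + B * Y * h r"
        using GX Pr BY hrc by (intro add_mult_distrib_mat) auto
      also have "B * Y * h r = B * S" using assoc_mult_mat[OF B Yc hrc] Yh by simp
      also have "G * X * Ps ! r * h r = G * (adj_mat P * Vs ! r)"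
        unfolding X_def assoc_mult_mat_5[OF G Ac uc Pr hrc] using V_nth[of r] by (simp add: dims r_def)
      finally show ?thesis using 3 T by (simp add: spread_tuple_nth P_def r_def)
    qed
  qed
  then show ?thesis using k h' unfolding Vs_def by blast
qed

text \<open>The factor \<open>det [P\<^sub>1 | \<dots> | P\<^sub>r]\<close> disposes of the points of the orbit at which the \<open>P\<^sub>i\<close> do not form a
  direct sum.  At the other points \<open>spread_tuple\<close> stays in the orbit of the lifted tuple, where \<open>F\<close>
  vanishes; genericity extends this from the orbit to all \<open>Vs\<close>.\<close>

lemma vanishing_spread:
  fixes Ps :: "'a::field mat list"
  assumes gen: "generic_tuple ds m Ps" and Ps: "Ps \<in> mat_tuples ds m"
    and F: "regular ds' n F"
    and van: "\<And>g h. g \<in> GL_mat n \<Longrightarrow> h \<in> base_changes ds' \<Longrightarrow> F (transform g h (lift_tuple as b Ps)) = 0"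
    and G: "G \<in> carrier_mat n m" and B: "B \<in> carrier_mat n b" and GB: "append_cols G B \<in> GL_mat n"
    and S: "S \<in> GL_mat b" and Vs: "Vs \<in> mat_tuples ds m"
  shows "det (hcat as m Vs) * F (spread_tuple as G B S Vs) = 0"
proof -
  have "regular_mat ds m m m (hcat as m)"
    using regular_mat_hcat[of as ds m] by (simp add: dims m_def)
  then have "regular ds m (\<lambda>Vs. det (hcat as m Vs) * F (spread_tuple as G B S Vs))"
    by (intro regular.mult regular_det regular_spread_tuple[OF G B GL_matD(1)[OF S] F])
  moreover have "det (hcat as m (transform u h Ps)) * F (spread_tuple as G B S (transform u h Ps)) = 0"
    if u: "u \<in> GL_mat m" and h: "h \<in> base_changes ds" for u h
  proof (cases "det (hcat as m (transform u h Ps)) = 0")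
    case False
    from spread_orbit[OF Ps G B GB S u h this] van show ?thesis by auto
  qed simp
  ultimately show ?thesis using gen Vs unfolding generic_tuple_def by blast
qed

text \<open>Let \<open>g = [M\<^sub>1 | \<dots> | M\<^sub>r | B]\<close> be invertible and write \<open>g\<inverse> B'\<close> as \<open>Q\<close> stacked on an invertible \<open>S\<close>.
  Then \<open>(M\<^sub>1, \<dots>, M\<^sub>r, B, B')\<close> is the spread tuple of the block units and \<open>Q\<close>, so \<open>F\<close> vanishes there.
  The two invertibility conditions are principal open, and they hold for the block units extended by
  zero, with both \<open>B\<close> and \<open>B'\<close> equal to the second summand.\<close>

lemma generic_lift_tuple:
  fixes Ps :: "'a::field mat list"
  assumes inf: "infinite (UNIV :: 'a set)"
    and gen: "generic_tuple ds m Ps" and Ps: "Ps \<in> mat_tuples ds m"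
  shows "generic_tuple ds' n (lift_tuple as b Ps)"
  unfolding generic_tuple_def
proof (intro allI impI ballI)
  fix F :: "'a mat list \<Rightarrow> 'a" and Ns :: "'a mat list"
  assume F: "regular ds' n F"
    and van: "\<forall>g \<in> GL_mat n. \<forall>h \<in> base_changes ds'. F (transform g h (lift_tuple as b Ps)) = 0"
    and Ns: "Ns \<in> mat_tuples ds' n"
  define r where "r = length as"
  define g where "g Ns = append_cols (hcat as n Ns) (Ns ! r)" for Ns :: "'a mat list"
  define C where "C Ns = adj_mat (g Ns) * Ns ! Suc r" for Ns :: "'a mat list"
  \<comment> \<open>The lower part of \<open>det g\<close> times \<open>g\<inverse> B'\<close>, which is polynomial in the entries.\<close>
  define S where "S Ns = mat b b (\<lambda>(k, l). C Ns $$ (m + k, l))" for Ns :: "'a mat list"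
  have reg_comp: "regular_mat ds' n n b (\<lambda>Ns. Ns ! r)" "regular_mat ds' n n b (\<lambda>Ns. Ns ! Suc r)"
    using regular_mat_component[of r ds' n] regular_mat_component[of "Suc r" ds' n]
    by (simp_all add: dims r_def)
  have reg_hcat: "regular_mat ds' n n m (hcat as n)"
    using regular_mat_hcat[of as ds' n] by (simp add: dims m_def)
  have reg_g: "regular_mat ds' n n n g"
    using regular_mat_append_cols[OF reg_hcat reg_comp(1)] by (simp add: g_def[abs_def] n_def m_def)
  have reg_C: "regular_mat ds' n n b C"
    unfolding C_def[abs_def] by (rule regular_mat_mult[OF regular_mat_adj[OF reg_g] reg_comp(2)])
  have reg_S: "regular_mat ds' n b b S"
    unfolding S_def[abs_def]
    by (rule regular_mat_entries) (use regular_matD(2)[OF reg_C] in \<open>auto simp: n_def m_def\<close>)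
  show "F Ns = 0"
  proof (rule regular_mult_eq_0[OF inf F])
    show "regular ds' n (\<lambda>Ns. det (g Ns) * det (S Ns))"
      by (intro regular.mult regular_det[OF reg_g] regular_det[OF reg_S])
    show "F Ns = 0" if Ns: "Ns \<in> mat_tuples ds' n" and nz: "det (g Ns) * det (S Ns) \<noteq> 0" for Ns
    proof -
      define G where "G = hcat as n Ns"
      define B where "B = Ns ! r"
      have G: "G \<in> carrier_mat n m" unfolding G_def m_def by simp
      have B: "B \<in> carrier_mat n b" and B': "Ns ! Suc r \<in> carrier_mat n b"
        using regular_matD(1)[OF reg_comp(1) Ns] regular_matD(1)[OF reg_comp(2) Ns] by (simp_all add: B_def)
      have gc: "g Ns \<in> carrier_mat n n" and Cc: "C Ns \<in> carrier_mat n b" and Sc: "S Ns \<in> carrier_mat b b"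
        using regular_matD(1) reg_g reg_C reg_S Ns by blast+
      have g_eq: "g Ns = append_cols G B" by (simp add: g_def G_def B_def)
      define \<delta> where "\<delta> = det (g Ns)"
      have \<delta>: "\<delta> \<noteq> 0" "det (S Ns) \<noteq> 0" using nz by (auto simp: \<delta>_def)
      define Q where "Q = mat m b (\<lambda>(k, l). C Ns $$ (k, l) / \<delta>)"
      define T where "T = (1 / \<delta>) \<cdot>\<^sub>m S Ns"
      have Qc: "Q \<in> carrier_mat m b" by (simp add: Q_def)
      have T: "T \<in> GL_mat b"
        unfolding T_def using \<delta> Sc by (intro smult_in_GL_mat GL_matI) auto
      note Tc = GL_matD(1)[OF T]
      have QT: "Q @\<^sub>r T = (1 / \<delta>) \<cdot>\<^sub>m C Ns"
      proof (rule eq_matI)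
        fix k l assume "k < dim_row ((1 / \<delta>) \<cdot>\<^sub>m C Ns)" "l < dim_col ((1 / \<delta>) \<cdot>\<^sub>m C Ns)"
        then have kl: "k < m + b" "l < b" using Cc by (auto simp: n_def m_def)
        show "(Q @\<^sub>r T) $$ (k, l) = ((1 / \<delta>) \<cdot>\<^sub>m C Ns) $$ (k, l)"
          using kl Cc by (subst append_rows_index[OF Qc Tc kl])
            (auto simp: Q_def T_def S_def n_def m_def)
      qed (use carrier_matD[OF carrier_append_rows[OF Qc Tc]] Cc in \<open>simp_all add: n_def m_def\<close>)
      have last: "G * Q + B * T = Ns ! Suc r"
      proof -
        have "G * Q + B * T = g Ns * ((1 / \<delta>) \<cdot>\<^sub>m C Ns)"
          unfolding g_eq QT[symmetric] by (rule append_cols_mult_append_rows[OF G B Qc Tc, symmetric])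
        also have "\<dots> = (1 / \<delta>) \<cdot>\<^sub>m (g Ns * C Ns)" by (rule mult_smult_distrib[OF gc Cc])
        also have "g Ns * C Ns = \<delta> \<cdot>\<^sub>m 1\<^sub>m n * Ns ! Suc r"
          unfolding C_def \<delta>_def using assoc_mult_mat[OF gc adj_mat(1)[OF gc] B'] adj_mat(2)[OF gc] by simp
        also have "\<dots> = \<delta> \<cdot>\<^sub>m Ns ! Suc r"
          using mult_smult_assoc_mat[OF one_carrier_mat B', of \<delta>] left_mult_one_mat[OF B'] by simp
        also have "(1 / \<delta>) \<cdot>\<^sub>m (\<delta> \<cdot>\<^sub>m Ns ! Suc r) = Ns ! Suc r"
          using \<delta> by (intro eq_matI) auto
        finally show ?thesis .
      qed
      \<comment> \<open>For block units \<open>P\<close> is the identity, so that spreading reproduces \<open>Q\<close> itself.\<close>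
      define Vs where "Vs = map (\<lambda>i. if i < r then block_unit as i else Q) [0..<Suc r]"
      have Vs_nth: "i < r \<Longrightarrow> Vs ! i = block_unit as i" "Vs ! r = Q" for i
        by (simp_all add: Vs_def del: upt_Suc)
      have "Vs ! i \<in> carrier_mat m (ds ! i)" if "i < length ds" for i
        using that Qc block_unit_carrier[of as i]
        by (cases "i = r") (auto simp: Vs_nth dims[folded r_def] m_def less_Suc_eq)
      then have Vs: "Vs \<in> mat_tuples ds m" by (simp add: mat_tuples_def Vs_def dims r_def)
      have P: "hcat as m Vs = 1\<^sub>m m"
        unfolding m_def by (rule hcat_block_units) (simp add: Vs_nth r_def)
      have "det (hcat as m Vs) * F (spread_tuple as G B T Vs) = 0"
      proof (rule vanishing_spread[OF gen Ps F _ G B _ T Vs])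
        show "F (transform g h (lift_tuple as b Ps)) = 0" if "g \<in> GL_mat n" "h \<in> base_changes ds'" for g h
          using van that by blast
        show "append_cols G B \<in> GL_mat n"
          unfolding g_eq[symmetric] using gc \<delta>(1) by (intro GL_matI) (simp_all add: \<delta>_def)
      qed
      moreover have "spread_tuple as G B T Vs = Ns"
      proof (rule nth_equalityI)
        show "length (spread_tuple as G B T Vs) = length Ns"
          using mat_tuplesD(1)[OF Ns] by (simp add: length_spread_tuple)
        fix i assume "i < length (spread_tuple as G B T Vs)"
        then have "i < length ds'" by (simp add: length_spread_tuple)
        then show "spread_tuple as G B T Vs ! i = Ns ! i"
        proof (cases rule: factor_cases)
          case 1
          then show ?thesis
            using hcat_mult_block_unit[OF 1, of Ns n] mat_tuplesD(2)[OF Ns, of i]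
            by (simp add: spread_tuple_nth G_def dims)
        next
          case 2
          then show ?thesis by (simp add: spread_tuple_nth B_def r_def)
        next
          case 3
          then show ?thesis
            using last left_mult_one_mat[OF Qc] Vs_nth(2)
            by (simp add: spread_tuple_nth P adj_mat_one r_def)
        qed
      qed
      ultimately show ?thesis by (simp add: P)
    qed
    define E where "E = map (\<lambda>i. if i < r then block_unit as i @\<^sub>r 0\<^sub>m b (as ! i)
      else 0\<^sub>m m b @\<^sub>r (1\<^sub>m b :: 'a mat)) [0..<Suc (Suc r)]"
    have E_nth: "i < r \<Longrightarrow> E ! i = block_unit as i @\<^sub>r 0\<^sub>m b (as ! i)"
      "E ! r = 0\<^sub>m m b @\<^sub>r 1\<^sub>m b" "E ! Suc r = 0\<^sub>m m b @\<^sub>r 1\<^sub>m b" for i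
      by (simp_all add: E_def del: upt_Suc)
    have lastc: "0\<^sub>m m b @\<^sub>r 1\<^sub>m b \<in> carrier_mat n b" by (simp add: n_def m_def)
    have "E ! i \<in> carrier_mat n (ds' ! i)" if "i < length ds'" for i
      using that
    proof (cases rule: factor_cases)
      case 1
      then show ?thesis
        using carrier_append_rows[OF block_unit_carrier zero_carrier_mat, of as i b]
        by (simp add: E_nth r_def dims n_def)
    qed (use lastc E_nth in \<open>simp_all add: dims r_def\<close>)
    then show "E \<in> mat_tuples ds' n" by (simp add: mat_tuples_def E_def dims r_def)
    have "hcat as n E = 1\<^sub>m m @\<^sub>r 0\<^sub>m b m"
      unfolding n_def m_def by (rule hcat_block_units_append_zero) (simp add: E_nth r_def)
    then have gE: "g E = 1\<^sub>m n"
      using append_cols_unit[of m b, where 'a = 'a] by (simp add: g_def E_nth n_def m_def)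
    have CE: "C E = 0\<^sub>m m b @\<^sub>r 1\<^sub>m b"
      using left_mult_one_mat[OF lastc] by (simp add: C_def gE adj_mat_one E_nth)
    have "S E = 1\<^sub>m b"
      unfolding S_def CE
      by (rule eq_matI) (auto simp: append_rows_index[OF zero_carrier_mat one_carrier_mat])
    then show "det (g E) * det (S E) \<noteq> 0" by (simp add: gE)
  qed (rule Ns)
qed

end

theorem lemma4p6:
  fixes as :: "nat list" and b n :: nat
  assumes "dimension_vector (as @ [b, b]) n"
    and "b + sum_list as = n"
    and "real b \<le> real n / 2"
    and "dense_dim_vector TYPE('a::alg_closed_field) (as @ [b]) (n - b)"
  shows "dense_dim_vector TYPE('a) (as @ [b, b]) n"
proof -
  have n: "n - b = sum_list as" "n = sum_list as + b" using assms(2) by auto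
  obtain Ps :: "'a mat list" where Ps: "Ps \<in> mat_tuples (as @ [b]) (sum_list as)"
    and gen: "generic_tuple (as @ [b]) (sum_list as) Ps"
    and inj: "\<And>i. i < length (as @ [b]) \<Longrightarrow> injective_mat ((as @ [b]) ! i) (Ps ! i)"
    using dense_imp_generic_tuple[OF infinite_alg_closed_field assms(4)] unfolding n(1) by blast
  show ?thesis
    unfolding n(2)
    by (rule generic_tuple_imp_dense[OF lift_tuple_in_mat_tuples[OF Ps]
          generic_lift_tuple[OF infinite_alg_closed_field gen Ps] injective_lift_tuple[OF Ps inj]])
qed

end
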